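(* Let $$L=\tfrac12\left(g_{\alpha\beta}\dot x^\alpha\dot x^\beta+2g_{\alpha a}\dot x^\alpha\dot\theta^a+g_{ab}\dot\theta^a\dot\theta^b\right)-V(x)$$ be a mechanical Lagrangian whose coefficients depend only on $x=(x^\alpha)$, let $\tau^a_\alpha(x)$ and symmetric $\sigma_{ab}(x)$ be smooth functions, and consider the controlled Euler-Lagrange system $\tilde\Phi_\alpha=0$, $\tilde\Phi_a=0$, where $$\tilde\Phi_\alpha=\frac{d}{dt}\frac{\partial L}{\partial\dot x^\alpha}-\frac{\partial L}{\partial x^\alpha},\qquad \tilde\Phi_a=\frac{d}{dt}\left(\frac{\partial L}{\partial\dot\theta^a}+g_{ab}\tau^b_\beta\dot x^\beta\right).$$ Assume that the matrix $\tilde C=(\partial\tilde\Phi_i/\partial\ddot q^j)$ is invertible, with $q=(x^\alpha,\theta^a)$. Let $$\tilde F_\alpha=\left(g_{\alpha\beta}+g_{\alpha a}\tau^a_\beta+g_{\beta a}\tau^a_\alpha+g_{ab}\tau^a_\alpha\tau^b_\beta+\sigma_{ab}\tau^a_\alpha\tau^b_\beta\right)\dot x^\beta+(g_{\alpha b}+g_{db}\tau^d_\alpha)\dot\theta^b,$$ $$\tilde F_a=(g_{\alpha a}+g_{da}\tau^d_\alpha)\dot x^\alpha+g_{ab}\dot\theta^b .$$ Consider the implicit Helmholtz conditions $(B)_{ij}$, $(AB)_{ij}$, $(AA)_{ij}$ defined in the context, for $\Phi=\tilde\Phi$ and $F=\tilde F$. Then: 1. $(B)_{ij}$ holds identically for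 all indices $i,j$. 2. $(AB)_{ab}$ and $(AB)_{a\beta}$ hold identically. $(AB)_{\alpha b}$ holds if conditions M1 and M3 hold; alternatively, it holds if $(g_{ab})$ is constant and the system has one degree of underactuation. $(AB)_{\alpha\beta}$ holds if M1, M2 and M3 hold. 3. $(AA)_{ab}$ and $(AA)_{\alpha b}$ hold identically. $(AA)_{\alpha\beta}$ holds (at all points where $\tilde\Phi=0$) if M1, M2 and M3 hold; alternatively, it holds for systems with one degree of underactuation. The conditions M1-M3 are: M1: $\tau^b_\alpha=-\sigma^{ab}g_{\alpha a}$; M2: $\sigma^{bd}(\sigma_{ad,\alpha}+g_{ad,\alpha})=2g^{bd}g_{ad,\alpha}$; M3: $\tau^b_{\alpha,\beta}-\tau^b_{\beta,\alpha}=g^{db}g_{ad,\alpha}\tau^a_\beta$.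
   Context: Conventions: repeated indices are summed; Greek indices label the unactuated variables $x^\alpha$ and Latin indices $a,b,c,d$ the actuated variables $\theta^a$; $i,j,k,r$ label all coordinates $q^i$, $(q^i)=(x^\alpha,\theta^a)$. A subscript $,\alpha$ denotes $\partial/\partial x^\alpha$. $(g^{ab})$ is the inverse of $(g_{ab})$, and $(\sigma^{ab})$ is the inverse of $(\sigma_{ab})$ (assumed to exist whenever M1 or M2 is used). The full matrix formed by $g_{\alpha\beta},g_{\alpha a},g_{ab}$ is the symmetric positive definite matrix of a Riemannian metric. "One degree of underactuation" means there is only one variable $x^\alpha$. The functions $\tilde F_i$ are the components $\partial L_{\tau,\sigma}/\partial\dot q^i$ of the Legendre transformation of the controlled Lagrangian $L_{\tau,\sigma}(x,\dot x,\dot\theta)=L(x,\dot x,\dot\theta^a+\tau^a_\alpha\dot x^\alpha)+\tfrac12\sigma_{ab}\tau^a_\alpha\tau^b_\beta\dot x^\alpha\dot x^\beta$. Implicit Helmholtz conditions. For an implicit second order system $\Phi_i(q,\dot q,\ddot q)=0$ with $C=(\partial\Phi_i/\partial\ddot q^j)$ invertible and functions $F_i(q,\dot q)$, they are $$(B)_{ij}:\quad \frac{\partial F_i}{\partial\dot q^j}=\frac{\partial F_j}{\partial\dot q^i},$$ $$(AB)_{ij}:\quad \frac{\partial^2F_i}{\partial\dot q^j\partial q^k}\dot q^k+\frac{\partial F_i}{\partial q^j}+\frac{\partial^2F_i}{\partial\dot q^j\partial\dot q^k}\ddot q^k-\frac{\partial F_j}{\partial q^i}=\frac{\partial F_i}{\partial\dot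 q^k}\frac{\partial\Phi_r}{\partial\dot q^j}(C^{-1})^{kr},$$ $$(AA)_{ij}:\quad \frac{\partial^2F_i}{\partial q^j\partial q^k}\dot q^k+\frac{\partial^2F_i}{\partial q^j\partial\dot q^k}\ddot q^k-\frac{\partial F_i}{\partial\dot q^k}\frac{\partial\Phi_r}{\partial q^j}(C^{-1})^{kr}=\frac{\partial^2F_j}{\partial q^i\partial q^k}\dot q^k+\frac{\partial^2F_j}{\partial q^i\partial\dot q^k}\ddot q^k-\frac{\partial F_j}{\partial\dot q^k}\frac{\partial\Phi_r}{\partial q^i}(C^{-1})^{kr}.$$ Subscripts such as $(AB)_{a\beta}$ denote the subset of equations with $q^i=\theta^a$ and $q^j=x^\beta$, and similarly for other index pairs. In $\tilde\Phi_\alpha,\tilde\Phi_a$ the time derivatives are expanded so that $\tilde\Phi_i$ is a function of $(q,\dot q,\ddot q)$, and $(C^{-1})$ is $\tilde C^{-1}$. "Holds identically" means for all $(q,\dot q,\ddot q)$. *)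

theory Defs
  imports "HOL-Analysis.Analysis"
begin

text \<open>
  The unactuated variables are indexed by a finite type \<open>'n\<close> and the actuated ones by a finite
  type \<open>'m\<close>; all coordinates together are indexed by the sum type, \<open>Inl \<alpha>\<close> standing for
  \<open>x^\<alpha>\<close> and \<open>Inr a\<close> for \<open>\<theta>^a\<close>. The letters \<open>q\<close>, \<open>v\<close>, \<open>w\<close> denote position, velocity
  and acceleration.
\<close>

definition pderiv_at :: "'k \<Rightarrow> (real^'k \<Rightarrow> real) \<Rightarrow> real^'k \<Rightarrow> real" where
  "pderiv_at k f p = deriv (\<lambda>t. f (p + t *\<^sub>R axis k 1)) 0"

primrec Ck_on :: "nat \<Rightarrow> (real^'n) set \<Rightarrow> (real^'n \<Rightarrow> real) \<Rightarrow> bool" where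
  "Ck_on 0 U f \<longleftrightarrow> continuous_on U f"
| "Ck_on (Suc k) U f \<longleftrightarrow> f differentiable_on U \<and> (\<forall>i. Ck_on k U (pderiv_at i f))"

text \<open>Only used for open \<open>U\<close>.\<close>

definition smooth_on :: "(real^'n) set \<Rightarrow> (real^'n \<Rightarrow> real) \<Rightarrow> bool" where
  "smooth_on U f \<longleftrightarrow> (\<forall>k. Ck_on k U f)"

definition pos_def_matrix :: "real^'k^'k \<Rightarrow> bool" where
  "pos_def_matrix A \<longleftrightarrow> transpose A = A \<and> (\<forall>v. v \<noteq> 0 \<longrightarrow> v \<bullet> (A *v v) > 0)"

text \<open>The expanded time derivative \<open>dG/dt\<close> of a function \<open>G(q, v)\<close>.\<close>

definition time_deriv ::
  "(real^'k \<Rightarrow> real^'k \<Rightarrow> real) \<Rightarrow> real^'k \<Rightarrow> real^'k \<Rightarrow> real^'k \<Rightarrow> real" where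
  "time_deriv G q v w =
     (\<Sum>k\<in>UNIV. pderiv_at k (\<lambda>q'. G q' v) q * v $ k) +
     (\<Sum>k\<in>UNIV. pderiv_at k (\<lambda>v'. G q v') v * w $ k)"


section \<open>Implicit Helmholtz conditions\<close>

text \<open>The matrix \<open>C\<close> of an implicit second order system \<open>\<Phi>\<^sub>i(q, v, w) = 0\<close>.\<close>

definition acc_matrix ::
  "('k \<Rightarrow> real^'k \<Rightarrow> real^'k \<Rightarrow> real^'k \<Rightarrow> real) \<Rightarrow> real^'k \<Rightarrow> real^'k \<Rightarrow> real^'k \<Rightarrow> real^'k^'k" where
  "acc_matrix \<Phi> q v w = (\<chi> i j. pderiv_at j (\<lambda>w'. \<Phi> i q v w') w)"

definition helmholtz_B ::
  "('k \<Rightarrow> real^'k \<Rightarrow> real^'k \<Rightarrow> real) \<Rightarrow> 'k \<Rightarrow> 'k \<Rightarrow> real^'k \<Rightarrow> real^'k \<Rightarrow> bool" where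
  "helmholtz_B F i j q v \<longleftrightarrow>
     pderiv_at j (\<lambda>v'. F i q v') v = pderiv_at i (\<lambda>v'. F j q v') v"

definition helmholtz_AB ::
  "('k \<Rightarrow> real^'k \<Rightarrow> real^'k \<Rightarrow> real^'k \<Rightarrow> real) \<Rightarrow> ('k \<Rightarrow> real^'k \<Rightarrow> real^'k \<Rightarrow> real) \<Rightarrow>
   'k \<Rightarrow> 'k \<Rightarrow> real^'k \<Rightarrow> real^'k \<Rightarrow> real^'k \<Rightarrow> bool" where
  "helmholtz_AB \<Phi> F i j q v w \<longleftrightarrow>
     (\<Sum>k\<in>UNIV. pderiv_at j (\<lambda>v'. pderiv_at k (\<lambda>q'. F i q' v') q) v * v $ k)
     + pderiv_at j (\<lambda>q'. F i q' v) q
     + (\<Sum>k\<in>UNIV. pderiv_at j (\<lambda>v'. pderiv_at k (\<lambda>v''. F i q v'') v') v * w $ k)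
     - pderiv_at i (\<lambda>q'. F j q' v) q
     = (\<Sum>k\<in>UNIV. \<Sum>r\<in>UNIV. pderiv_at k (\<lambda>v'. F i q v') v * pderiv_at j (\<lambda>v'. \<Phi> r q v' w) v
          * matrix_inv (acc_matrix \<Phi> q v w) $ k $ r)"

text \<open>Both sides of \<open>(AA)\<^sub>i\<^sub>j\<close> are the same expression with \<open>i\<close> and \<open>j\<close> interchanged.\<close>

definition helmholtz_AA_side ::
  "('k \<Rightarrow> real^'k \<Rightarrow> real^'k \<Rightarrow> real^'k \<Rightarrow> real) \<Rightarrow> ('k \<Rightarrow> real^'k \<Rightarrow> real^'k \<Rightarrow> real) \<Rightarrow>
   'k \<Rightarrow> 'k \<Rightarrow> real^'k \<Rightarrow> real^'k \<Rightarrow> real^'k \<Rightarrow> real" where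
  "helmholtz_AA_side \<Phi> F i j q v w =
     (\<Sum>k\<in>UNIV. pderiv_at j (\<lambda>q'. pderiv_at k (\<lambda>q''. F i q'' v) q') q * v $ k)
     + (\<Sum>k\<in>UNIV. pderiv_at j (\<lambda>q'. pderiv_at k (\<lambda>v'. F i q' v') v) q * w $ k)
     - (\<Sum>k\<in>UNIV. \<Sum>r\<in>UNIV. pderiv_at k (\<lambda>v'. F i q v') v * pderiv_at j (\<lambda>q'. \<Phi> r q' v w) q
          * matrix_inv (acc_matrix \<Phi> q v w) $ k $ r)"

definition helmholtz_AA ::
  "('k \<Rightarrow> real^'k \<Rightarrow> real^'k \<Rightarrow> real^'k \<Rightarrow> real) \<Rightarrow> ('k \<Rightarrow> real^'k \<Rightarrow> real^'k \<Rightarrow> real) \<Rightarrow>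
   'k \<Rightarrow> 'k \<Rightarrow> real^'k \<Rightarrow> real^'k \<Rightarrow> real^'k \<Rightarrow> bool" where
  "helmholtz_AA \<Phi> F i j q v w \<longleftrightarrow>
     helmholtz_AA_side \<Phi> F i j q v w = helmholtz_AA_side \<Phi> F j i q v w"


section \<open>The controlled system\<close>

definition xpart :: "real^('n::finite + 'm::finite) \<Rightarrow> real^'n" where
  "xpart q = (\<chi> \<alpha>. q $ Inl \<alpha>)"

text \<open>
  The metric is one matrix \<open>g x\<close> over all indices; its blocks are
  \<open>g x $ Inl \<alpha> $ Inl \<beta>\<close>, \<open>g x $ Inl \<alpha> $ Inr a\<close> and \<open>g x $ Inr a $ Inr b\<close>.
  The component \<open>\<tau>^a\<^sub>\<alpha>\<close> is \<open>\<tau> x $ a $ \<alpha>\<close>.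
\<close>

definition act_block ::
  "(real^'n \<Rightarrow> real^('n::finite + 'm::finite)^('n + 'm)) \<Rightarrow> real^'n \<Rightarrow> real^'m^'m" where
  "act_block g x = (\<chi> a b. g x $ Inr a $ Inr b)"

definition lagrangian ::
  "(real^'n \<Rightarrow> real^('n::finite + 'm::finite)^('n + 'm)) \<Rightarrow> (real^'n \<Rightarrow> real) \<Rightarrow>
   real^('n + 'm) \<Rightarrow> real^('n + 'm) \<Rightarrow> real" where
  "lagrangian g V q v = (let x = xpart q in
     1/2 * ((\<Sum>\<alpha>\<in>UNIV. \<Sum>\<beta>\<in>UNIV. g x $ Inl \<alpha> $ Inl \<beta> * v $ Inl \<alpha> * v $ Inl \<beta>)
            + 2 * (\<Sum>\<alpha>\<in>UNIV. \<Sum>a\<in>UNIV. g x $ Inl \<alpha> $ Inr a * v $ Inl \<alpha> * v $ Inr a)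
            + (\<Sum>a\<in>UNIV. \<Sum>b\<in>UNIV. g x $ Inr a $ Inr b * v $ Inr a * v $ Inr b))
     - V x)"

definition controlled_EL ::
  "(real^'n \<Rightarrow> real^('n::finite + 'm::finite)^('n + 'm)) \<Rightarrow> (real^'n \<Rightarrow> real) \<Rightarrow>
   (real^'n \<Rightarrow> real^'n^'m) \<Rightarrow>
   'n + 'm \<Rightarrow> real^('n + 'm) \<Rightarrow> real^('n + 'm) \<Rightarrow> real^('n + 'm) \<Rightarrow> real" where
  "controlled_EL g V \<tau> i q v w = (case i of
     Inl \<alpha> \<Rightarrow>
       time_deriv (\<lambda>q' v'. pderiv_at (Inl \<alpha>) (\<lambda>v''. lagrangian g V q' v'') v') q v w
       - pderiv_at (Inl \<alpha>) (\<lambda>q'. lagrangian g V q' v) q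
   | Inr a \<Rightarrow>
       time_deriv (\<lambda>q' v'. pderiv_at (Inr a) (\<lambda>v''. lagrangian g V q' v'') v'
         + (\<Sum>b\<in>UNIV. \<Sum>\<beta>\<in>UNIV. g (xpart q') $ Inr a $ Inr b * \<tau> (xpart q') $ b $ \<beta> * v' $ Inl \<beta>))
         q v w)"

definition controlled_F ::
  "(real^'n \<Rightarrow> real^('n::finite + 'm::finite)^('n + 'm)) \<Rightarrow> (real^'n \<Rightarrow> real^'n^'m) \<Rightarrow>
   (real^'n \<Rightarrow> real^'m^'m) \<Rightarrow>
   'n + 'm \<Rightarrow> real^('n + 'm) \<Rightarrow> real^('n + 'm) \<Rightarrow> real" where
  "controlled_F g \<tau> \<sigma> i q v = (let x = xpart q in case i of
     Inl \<alpha> \<Rightarrow>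
       (\<Sum>\<beta>\<in>UNIV.
          (g x $ Inl \<alpha> $ Inl \<beta>
           + (\<Sum>a\<in>UNIV. g x $ Inl \<alpha> $ Inr a * \<tau> x $ a $ \<beta>)
           + (\<Sum>a\<in>UNIV. g x $ Inl \<beta> $ Inr a * \<tau> x $ a $ \<alpha>)
           + (\<Sum>a\<in>UNIV. \<Sum>b\<in>UNIV. g x $ Inr a $ Inr b * \<tau> x $ a $ \<alpha> * \<tau> x $ b $ \<beta>)
           + (\<Sum>a\<in>UNIV. \<Sum>b\<in>UNIV. \<sigma> x $ a $ b * \<tau> x $ a $ \<alpha> * \<tau> x $ b $ \<beta>)) * v $ Inl \<beta>)
       + (\<Sum>b\<in>UNIV. (g x $ Inl \<alpha> $ Inr b + (\<Sum>d\<in>UNIV. g x $ Inr d $ Inr b * \<tau> x $ d $ \<alpha>)) * v $ Inr b)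
   | Inr a \<Rightarrow>
       (\<Sum>\<alpha>\<in>UNIV. (g x $ Inl \<alpha> $ Inr a + (\<Sum>d\<in>UNIV. g x $ Inr d $ Inr a * \<tau> x $ d $ \<alpha>)) * v $ Inl \<alpha>)
       + (\<Sum>b\<in>UNIV. g x $ Inr a $ Inr b * v $ Inr b))"

definition cond_M1 ::
  "(real^'n) set \<Rightarrow> (real^'n \<Rightarrow> real^('n::finite + 'm::finite)^('n + 'm)) \<Rightarrow>
   (real^'n \<Rightarrow> real^'n^'m) \<Rightarrow> (real^'n \<Rightarrow> real^'m^'m) \<Rightarrow> bool" where
  "cond_M1 U g \<tau> \<sigma> \<longleftrightarrow> (\<forall>x\<in>U. \<forall>b \<alpha>.
     \<tau> x $ b $ \<alpha> = - (\<Sum>a\<in>UNIV. matrix_inv (\<sigma> x) $ a $ b * g x $ Inl \<alpha> $ Inr a))"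

definition cond_M2 ::
  "(real^'n) set \<Rightarrow> (real^'n \<Rightarrow> real^('n::finite + 'm::finite)^('n + 'm)) \<Rightarrow>
   (real^'n \<Rightarrow> real^'m^'m) \<Rightarrow> bool" where
  "cond_M2 U g \<sigma> \<longleftrightarrow> (\<forall>x\<in>U. \<forall>a b \<alpha>.
     (\<Sum>d\<in>UNIV. matrix_inv (\<sigma> x) $ b $ d *
        (pderiv_at \<alpha> (\<lambda>y. \<sigma> y $ a $ d) x + pderiv_at \<alpha> (\<lambda>y. g y $ Inr a $ Inr d) x))
     = 2 * (\<Sum>d\<in>UNIV. matrix_inv (act_block g x) $ b $ d * pderiv_at \<alpha> (\<lambda>y. g y $ Inr a $ Inr d) x))"

definition cond_M3 ::
  "(real^'n) set \<Rightarrow> (real^'n \<Rightarrow> real^('n::finite + 'm::finite)^('n + 'm)) \<Rightarrow>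
   (real^'n \<Rightarrow> real^'n^'m) \<Rightarrow> bool" where
  "cond_M3 U g \<tau> \<longleftrightarrow> (\<forall>x\<in>U. \<forall>b \<alpha> \<beta>.
     pderiv_at \<beta> (\<lambda>y. \<tau> y $ b $ \<alpha>) x - pderiv_at \<alpha> (\<lambda>y. \<tau> y $ b $ \<beta>) x
     = (\<Sum>d\<in>UNIV. \<Sum>a\<in>UNIV. matrix_inv (act_block g x) $ d $ b
          * pderiv_at \<alpha> (\<lambda>y. g y $ Inr a $ Inr d) x * \<tau> x $ a $ \<beta>))"

text \<open>
  The coefficients live on an open set \<open>U\<close> of values of \<open>x\<close>; \<open>\<theta>\<close>, \<open>v\<close> and \<open>w\<close> are
  unrestricted.
\<close>

definition identically_on ::
  "(real^'n) set \<Rightarrow> (real^('n::finite + 'm::finite) \<Rightarrow> real^('n + 'm) \<Rightarrow> real^('n + 'm) \<Rightarrow> bool) \<Rightarrow> bool" where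
  "identically_on U P \<longleftrightarrow> (\<forall>q v w. xpart q \<in> U \<longrightarrow> P q v w)"

end

theory Submission
  imports Defs
begin

text \<open>
  Both \<open>\<Phi>\<close> and \<open>F\<close> are built from matrices depending on \<open>x\<close> alone: \<open>F\<close> is \<open>M(x) v\<close> with a symmetric
  Legendre matrix \<open>M\<close>, which is condition \<open>(B)\<close>, and the coefficient matrix of the accelerations in
  \<open>\<Phi>\<close> is some \<open>C(x)\<close>. The conditions \<open>(AB)\<close> and \<open>(AA)\<close> see \<open>C\<^sup>-\<^sup>1\<close> only through the rows of
  \<open>M C\<^sup>-\<^sup>1\<close>, so nothing has to be inverted once a row of \<open>M\<close> is written as a combination of
  rows of \<open>C\<close> (lemma \<open>C_inverse_contract\<close>). An actuated row of \<open>M\<close> is a row of \<open>C\<close>,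
  because \<open>\<Phi>\<^sub>a = dF\<^sub>a/dt\<close>; this gives the conditions whose first index is actuated, and those of
  \<open>(AA)\<close> whose second index is actuated follow since nothing depends on \<open>\<theta>\<close>. Condition M1
  makes the row of \<open>\<alpha>\<close> equal to row \<open>\<alpha>\<close> of \<open>C\<close> plus \<open>\<tau>\<^sup>a\<^sub>\<alpha>\<close> times row \<open>a\<close>
  (lemma \<open>leg_Inl_eq\<close>).

  What remains is an identity between vectors indexed by the actuated variables. Let \<open>G\<close> and \<open>S\<close> be
  the matrices of \<open>g\<^sub>a\<^sub>b\<close> and \<open>\<sigma>\<^sub>a\<^sub>b\<close>, let \<open>H = G - S\<close> and \<open>\<Gamma>\<^sub>\<alpha> = G\<^sup>-\<^sup>1 \<partial>\<^sub>\<alpha>G\<close>, let \<open>\<tau>\<^sub>\<alpha>\<close> be the columns of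
  \<open>\<tau>\<close>, and let \<open>u\<close> and \<open>y\<close> be the unactuated and actuated velocities. Then M3 reads
  \<open>\<partial>\<^sub>\<beta>\<tau>\<^sub>\<alpha> - \<partial>\<^sub>\<alpha>\<tau>\<^sub>\<beta> = \<Gamma>\<^sub>\<alpha>\<tau>\<^sub>\<beta>\<close>, M2 reads \<open>\<partial>\<^sub>\<alpha>H = 2 H \<Gamma>\<^sub>\<alpha>\<close>, and M1 turns the actuated part of \<open>F\<close> into
  \<open>f = H \<tau>\<^sub>u + G y\<close>, where \<open>\<tau>\<^sub>u = \<Sum> u\<^sup>\<gamma>\<tau>\<^sub>\<gamma>\<close>. Since \<open>G \<Gamma>\<^sub>\<alpha> = \<partial>\<^sub>\<alpha>G\<close> and \<open>H \<Gamma>\<^sub>\<alpha>\<close> are both symmetric, for every vector \<open>x\<close>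
    \<open>x \<bullet> \<partial>\<^sub>\<alpha>f = (\<Gamma>\<^sub>\<alpha> x) \<bullet> f + x \<bullet> H \<tau>'\<^sub>\<alpha>\<close>
  with \<open>\<tau>'\<^sub>\<alpha>\<close> the time derivative of \<open>\<tau>\<^sub>\<alpha>\<close> (lemma \<open>inner_dF_act\<close>). For \<open>x = \<tau>\<^sub>\<beta>\<close> this is
  \<open>(AB)\<^sub>\<alpha>\<^sub>\<beta>\<close>.

  In \<open>(AA)\<^sub>\<alpha>\<^sub>\<beta>\<close> the forces \<open>\<Phi>\<^sub>a\<close> occur with a coefficient that is not symmetric, which is why
  the equations of motion are imposed there. Once they are gone, the same identity with
  \<open>x = \<tau>'\<^sub>\<alpha>\<close> and \<open>x = \<tau>'\<^sub>\<beta>\<close> reduces the condition to the second order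
  consequence \<open>\<partial>\<^sub>\<gamma>(\<partial>\<^sub>\<beta>\<tau>\<^sub>\<alpha> - \<partial>\<^sub>\<alpha>\<tau>\<^sub>\<beta>) = \<Gamma>\<^sub>\<alpha> \<partial>\<^sub>\<gamma>\<tau>\<^sub>\<beta> - \<Gamma>\<^sub>\<beta> \<partial>\<^sub>\<gamma>\<tau>\<^sub>\<alpha>\<close> of M3 (lemma \<open>M3_second_order\<close>). That one
  holds because the left side of M3 is alternating, so its right side is too, and closed, so
  that its cyclic sum of derivatives vanishes.
\<close>



section \<open>Partial derivatives\<close>

lemma has_pderiv_at:
  fixes f :: "real^'k \<Rightarrow> real"
  assumes "f differentiable (at p)"
  shows "((\<lambda>t. f (p + t *\<^sub>R axis k 1)) has_real_derivative pderiv_at k f p) (at 0)"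
proof -
  have "(f has_derivative frechet_derivative f (at p)) (at (p + 0 *\<^sub>R axis k 1))"
    using assms by (simp add: frechet_derivative_works)
  moreover have "((\<lambda>t. p + t *\<^sub>R axis k 1) has_vector_derivative axis k 1) (at 0)"
    by (auto intro!: derivative_eq_intros)
  ultimately have "((\<lambda>t. f (p + t *\<^sub>R axis k 1)) has_vector_derivative
      frechet_derivative f (at p) (axis k 1)) (at 0)"
    using vector_derivative_diff_chain_within
      [of "\<lambda>t. p + t *\<^sub>R axis k 1" "axis k 1" 0 UNIV f "frechet_derivative f (at p)"]
    by (simp add: o_def has_derivative_at_withinI)
  then show ?thesis
    unfolding pderiv_at_def
    by (metis DERIV_deriv_iff_field_differentiable field_differentiable_def
        has_real_derivative_iff_has_vector_derivative)
qed

lemma pderiv_atI: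
  "((\<lambda>t. f (p + t *\<^sub>R axis k 1)) has_real_derivative D) (at 0) \<Longrightarrow> pderiv_at k f p = D"
  by (simp add: pderiv_at_def DERIV_imp_deriv)

lemma pderiv_at_frechet:
  fixes f :: "real^'k \<Rightarrow> real"
  assumes "(f has_derivative f') (at p)"
  shows "pderiv_at k f p = f' (axis k 1)"
proof (rule pderiv_atI)
  have "((\<lambda>t. p + t *\<^sub>R axis k 1) has_vector_derivative axis k 1) (at 0)"
    by (auto intro!: derivative_eq_intros)
  then show "((\<lambda>t. f (p + t *\<^sub>R axis k 1)) has_real_derivative f' (axis k 1)) (at 0)"
    using vector_derivative_diff_chain_within
      [of "\<lambda>t. p + t *\<^sub>R axis k 1" "axis k 1" 0 UNIV f f'] assms
    by (simp add: o_def has_derivative_at_withinI has_real_derivative_iff_has_vector_derivative)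
qed

lemma pderiv_at_cong_open:
  assumes "open W" "p \<in> W" "\<And>q. q \<in> W \<Longrightarrow> f q = g q"
  shows "pderiv_at k f p = pderiv_at k g p"
  unfolding pderiv_at_def
proof (rule deriv_cong_ev)
  have "((\<lambda>t. p + t *\<^sub>R axis k 1) \<longlongrightarrow> p + 0 *\<^sub>R axis k 1) (nhds (0::real))"
    by (intro tendsto_intros filterlim_ident)
  then have "\<forall>\<^sub>F t in nhds (0::real). p + t *\<^sub>R axis k 1 \<in> W"
    using assms(1,2) by (auto simp: tendsto_def)
  then show "\<forall>\<^sub>F t in nhds (0::real). f (p + t *\<^sub>R axis k 1) = g (p + t *\<^sub>R axis k 1)"
    by eventually_elim (rule assms(3))
qed simp

lemma differentiable_cong_open:
  assumes "open W" "p \<in> W" "\<And>q. q \<in> W \<Longrightarrow> f q = g q" "g differentiable (at p)"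
  shows "f differentiable (at p)"
  using assms unfolding differentiable_def
  by (metis has_derivative_transform_within_open)

lemma pderiv_at_const [simp]: "pderiv_at k (\<lambda>q. c) p = 0"
  by (rule pderiv_atI) simp

lemma pderiv_at_add:
  assumes "f differentiable (at p)" "g differentiable (at p)"
  shows "pderiv_at k (\<lambda>q. f q + g q) p = pderiv_at k f p + pderiv_at k g p"
  by (rule pderiv_atI[OF DERIV_add[OF has_pderiv_at[OF assms(1)] has_pderiv_at[OF assms(2)]]])

lemma pderiv_at_diff:
  assumes "f differentiable (at p)" "g differentiable (at p)"
  shows "pderiv_at k (\<lambda>q. f q - g q) p = pderiv_at k f p - pderiv_at k g p"
  by (rule pderiv_atI[OF DERIV_diff[OF has_pderiv_at[OF assms(1)] has_pderiv_at[OF assms(2)]]])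

lemma pderiv_at_mult:
  assumes "f differentiable (at p)" "g differentiable (at p)"
  shows "pderiv_at k (\<lambda>q. f q * g q) p = pderiv_at k f p * g p + f p * pderiv_at k g p"
proof (rule pderiv_atI)
  show "((\<lambda>t. f (p + t *\<^sub>R axis k 1) * g (p + t *\<^sub>R axis k 1)) has_real_derivative
      pderiv_at k f p * g p + f p * pderiv_at k g p) (at 0)"
    using DERIV_mult[OF has_pderiv_at[OF assms(1)] has_pderiv_at[OF assms(2)]]
    by (simp add: mult.commute add.commute)
qed

lemma pderiv_at_sum:
  assumes "\<And>i. i \<in> A \<Longrightarrow> f i differentiable (at p)"
  shows "pderiv_at k (\<lambda>q. \<Sum>i\<in>A. f i q) p = (\<Sum>i\<in>A. pderiv_at k (f i) p)"
  by (rule pderiv_atI[OF DERIV_sum[OF has_pderiv_at[OF assms]]])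

lemma pderiv_at_cmult:
  assumes "f differentiable (at p)"
  shows "pderiv_at k (\<lambda>q. c * f q) p = c * pderiv_at k f p"
  using pderiv_at_mult[OF differentiable_const assms] by simp

lemma pderiv_at_multc:
  assumes "f differentiable (at p)"
  shows "pderiv_at k (\<lambda>q. f q * c) p = pderiv_at k f p * c"
  using pderiv_at_mult[OF assms differentiable_const] by simp

lemma differentiable_sum_finite:
  fixes f :: "'i::finite \<Rightarrow> real^'k \<Rightarrow> real"
  assumes "\<And>i. f i differentiable (at p)"
  shows "(\<lambda>q. \<Sum>i\<in>UNIV. f i q) differentiable (at p)"
  by (intro differentiable_sum) (use assms in auto)

lemma differentiable_vec_nth: "(\<lambda>v::real^'k. v $ i) differentiable F"
  by (rule bounded_linear_imp_differentiable) (rule bounded_linear_vec_nth)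

lemma pderiv_at_vec_nth: "pderiv_at j (\<lambda>v::real^'k. v $ i) p = (if i = j then 1 else 0)"
  by (rule trans[OF pderiv_at_frechet[OF bounded_linear_imp_has_derivative[OF bounded_linear_vec_nth]]])
    (auto simp: axis_def)

lemma pderiv_at_linear:
  "pderiv_at j (\<lambda>v::real^'k. \<Sum>i\<in>UNIV. c i * v $ i) p = c j"
  by (subst pderiv_at_sum)
    (simp_all add: pderiv_at_cmult differentiable_vec_nth pderiv_at_vec_nth if_distrib cong: if_cong)

lemma pderiv_at_quadratic:
  "pderiv_at l (\<lambda>v::real^'k. \<Sum>i\<in>UNIV. \<Sum>j\<in>UNIV. c i j * v $ j * v $ i) p
     = (\<Sum>j\<in>UNIV. (c l j + c j l) * p $ j)"
proof -
  have monomial: "pderiv_at l (\<lambda>v::real^'k. c i j * v $ j * v $ i) p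
      = (if j = l then c i j * p $ i else 0) + (if i = l then c i j * p $ j else 0)" for i j
    by (simp add: pderiv_at_mult pderiv_at_cmult differentiable_vec_nth pderiv_at_vec_nth)
  have "pderiv_at l (\<lambda>v::real^'k. \<Sum>i\<in>UNIV. \<Sum>j\<in>UNIV. c i j * v $ j * v $ i) p
      = (\<Sum>i\<in>UNIV. \<Sum>j\<in>UNIV. pderiv_at l (\<lambda>v::real^'k. c i j * v $ j * v $ i) p)"
    by (subst pderiv_at_sum, intro differentiable_sum_finite differentiable_mult
        differentiable_vec_nth differentiable_const)
      (intro sum.cong refl pderiv_at_sum differentiable_mult differentiable_vec_nth differentiable_const)
  also have "\<dots> = (\<Sum>i\<in>UNIV. c i l * p $ i) + (\<Sum>j\<in>UNIV. \<Sum>i\<in>UNIV. if i = l then c i j * p $ j else 0)"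
    unfolding monomial sum.distrib by (subst (2) sum.swap) simp
  finally show ?thesis
    by (simp add: sum.distrib algebra_simps)
qed

text \<open>
  The second difference of \<open>f\<close> over a small square is symmetric in the two directions; the mean
  value theorem in direction \<open>i\<close> followed by the linear approximation of \<open>pderiv_at i f\<close> at the
  corner shows that it is \<open>t\<^sup>2\<close> times a mixed derivative, up to a smaller error.
\<close>

lemma second_difference_bound:
  fixes f :: "real^'k \<Rightarrow> real"
  assumes "open W" "p \<in> W" and f: "\<And>q. q \<in> W \<Longrightarrow> f differentiable (at q)"
    and P: "pderiv_at i f differentiable (at p)" and "\<epsilon> > 0"
  shows "\<exists>\<delta>>0. \<forall>t. 0 < t \<and> t < \<delta> \<longrightarrow>
    \<bar>f (p + t *\<^sub>R axis i 1 + t *\<^sub>R axis j 1) - f (p + t *\<^sub>R axis i 1) - f (p + t *\<^sub>R axis j 1) + f p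
       - t\<^sup>2 * pderiv_at j (pderiv_at i f) p\<bar> \<le> \<epsilon> * t\<^sup>2"
proof -
  let ?P = "pderiv_at i f" and ?ei = "axis i 1 :: real^'k" and ?ej = "axis j 1 :: real^'k"
  obtain P' where P': "(?P has_derivative P') (at p)"
    using P unfolding differentiable_def by blast
  then have lin: "linear P'"
    by (rule has_derivative_linear)
  have D: "pderiv_at j ?P p = P' ?ej"
    by (rule pderiv_at_frechet[OF P'])
  obtain d where "d > 0"
    and d: "\<And>q. norm (q - p) < d \<Longrightarrow> \<bar>?P q - ?P p - P' (q - p)\<bar> \<le> \<epsilon> / 3 * norm (q - p)"
    using P' \<open>\<epsilon> > 0\<close> unfolding has_derivative_at_alt
    by (metis divide_pos_pos real_norm_def zero_less_numeral)
  obtain e where "e > 0" and e: "ball p e \<subseteq> W"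
    using assms(1,2) openE by blast
  \<comment> \<open>sides below \<open>\<delta>\<close> keep every \<open>z e\<^sub>i + s e\<^sub>j\<close> shorter than \<open>min d e\<close>, since its norm is at most \<open>z + s\<close>\<close>
  define \<delta> where "\<delta> = min d e / 2"
  have small: "norm (z *\<^sub>R ?ei + s *\<^sub>R ?ej) \<le> z + s" if "0 \<le> z" "0 \<le> s" for z s
    using norm_triangle_ineq[of "z *\<^sub>R ?ei" "s *\<^sub>R ?ej"] that by simp
  have "\<bar>f (p + t *\<^sub>R ?ei + t *\<^sub>R ?ej) - f (p + t *\<^sub>R ?ei) - f (p + t *\<^sub>R ?ej) + f p
       - t\<^sup>2 * P' ?ej\<bar> \<le> \<epsilon> * t\<^sup>2" if t: "0 < t" "t < \<delta>" for t
  proof -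
    have near: "p + z *\<^sub>R ?ei + s *\<^sub>R ?ej \<in> W \<and> norm (z *\<^sub>R ?ei + s *\<^sub>R ?ej) < d"
      if "0 \<le> z" "z \<le> t" "0 \<le> s" "s \<le> t" for z s
    proof -
      have "norm (z *\<^sub>R ?ei + s *\<^sub>R ?ej) < min d e"
        using small[of z s] that t by (auto simp: \<delta>_def)
      moreover have "dist p (p + (z *\<^sub>R ?ei + s *\<^sub>R ?ej)) = norm (z *\<^sub>R ?ei + s *\<^sub>R ?ej)"
        by (metis add_diff_cancel_left' dist_commute dist_norm)
      ultimately have "p + (z *\<^sub>R ?ei + s *\<^sub>R ?ej) \<in> ball p e \<and> norm (z *\<^sub>R ?ei + s *\<^sub>R ?ej) < d"
        by simp
      then show ?thesis
        using e by (auto simp: add.assoc)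
    qed
    have der: "((\<lambda>z. f (p + z *\<^sub>R ?ei + s *\<^sub>R ?ej)) has_real_derivative ?P (p + z *\<^sub>R ?ei + s *\<^sub>R ?ej)) (at z)"
      if "0 \<le> z" "z \<le> t" "0 \<le> s" "s \<le> t" for z s
    proof -
      have "((\<lambda>u. f ((p + z *\<^sub>R ?ei + s *\<^sub>R ?ej) + u *\<^sub>R ?ei)) has_real_derivative
          ?P (p + z *\<^sub>R ?ei + s *\<^sub>R ?ej)) (at 0)"
        using near[OF that] by (intro has_pderiv_at f) simp
      then have "((\<lambda>u. f (p + (u + z) *\<^sub>R ?ei + s *\<^sub>R ?ej)) has_real_derivative
          ?P (p + z *\<^sub>R ?ei + s *\<^sub>R ?ej)) (at 0)"
        by (simp add: algebra_simps)
      then show ?thesis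
        using DERIV_shift[of "\<lambda>z. f (p + z *\<^sub>R ?ei + s *\<^sub>R ?ej)" _ 0 z] by simp
    qed
    define \<phi> where "\<phi> z = f (p + z *\<^sub>R ?ei + t *\<^sub>R ?ej) - f (p + z *\<^sub>R ?ei + 0 *\<^sub>R ?ej)" for z
    have "(\<phi> has_real_derivative ?P (p + z *\<^sub>R ?ei + t *\<^sub>R ?ej) - ?P (p + z *\<^sub>R ?ei + 0 *\<^sub>R ?ej)) (at z)"
      if "0 \<le> z" "z \<le> t" for z
      unfolding \<phi>_def using that t by (intro DERIV_diff der) auto
    from MVT2[OF t(1) this] obtain z where z: "0 < z" "z < t"
      and mv: "\<phi> t - \<phi> 0 = (t - 0) * (?P (p + z *\<^sub>R ?ei + t *\<^sub>R ?ej) - ?P (p + z *\<^sub>R ?ei + 0 *\<^sub>R ?ej))"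
      by blast
    have a: "\<bar>?P (p + z *\<^sub>R ?ei + s *\<^sub>R ?ej) - ?P p - (z * P' ?ei + s * P' ?ej)\<bar> \<le> \<epsilon> / 3 * (z + s)"
      if "0 \<le> s" "s \<le> t" for s
    proof -
      have "norm ((p + z *\<^sub>R ?ei + s *\<^sub>R ?ej) - p) < d"
        using near[of z s] z that by (simp add: add.assoc)
      from d[OF this] have "\<bar>?P (p + z *\<^sub>R ?ei + s *\<^sub>R ?ej) - ?P p - P' (z *\<^sub>R ?ei + s *\<^sub>R ?ej)\<bar>
          \<le> \<epsilon> / 3 * norm (z *\<^sub>R ?ei + s *\<^sub>R ?ej)"
        by (simp add: add.assoc)
      also have "\<dots> \<le> \<epsilon> / 3 * (z + s)"
        using small[of z s] z that \<open>\<epsilon> > 0\<close> by (intro mult_left_mono) auto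
      finally show ?thesis
        by (simp add: linear_add[OF lin] linear_scale[OF lin])
    qed
    have "\<bar>?P (p + z *\<^sub>R ?ei + t *\<^sub>R ?ej) - ?P (p + z *\<^sub>R ?ei + 0 *\<^sub>R ?ej) - t * P' ?ej\<bar>
        \<le> \<epsilon> / 3 * (z + t) + \<epsilon> / 3 * (z + 0)"
      using a[of t] a[of 0] t by linarith
    also have "\<dots> = \<epsilon> / 3 * (2 * z + t)"
      by (simp add: field_simps)
    also have "\<dots> \<le> \<epsilon> / 3 * (3 * t)"
      using z \<open>\<epsilon> > 0\<close> by (intro mult_left_mono) auto
    finally have b: "\<bar>?P (p + z *\<^sub>R ?ei + t *\<^sub>R ?ej) - ?P (p + z *\<^sub>R ?ei + 0 *\<^sub>R ?ej) - t * P' ?ej\<bar> \<le> \<epsilon> * t"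
      by simp
    have "f (p + t *\<^sub>R ?ei + t *\<^sub>R ?ej) - f (p + t *\<^sub>R ?ei) - f (p + t *\<^sub>R ?ej) + f p - t\<^sup>2 * P' ?ej
        = t * (?P (p + z *\<^sub>R ?ei + t *\<^sub>R ?ej) - ?P (p + z *\<^sub>R ?ei + 0 *\<^sub>R ?ej) - t * P' ?ej)"
      using mv by (simp add: \<phi>_def algebra_simps power2_eq_square)
    also have "\<bar>\<dots>\<bar> \<le> t * (\<epsilon> * t)"
      unfolding abs_mult using mult_left_mono[OF b, of t] t by simp
    finally show ?thesis
      by (simp add: power2_eq_square mult.left_commute)
  qed
  then show ?thesis
    unfolding D using \<open>d > 0\<close> \<open>e > 0\<close> by (intro exI[of _ \<delta>]) (auto simp: \<delta>_def)
qed

text \<open>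
  Young's form of the symmetry of mixed derivatives: total differentiability of the first partial
  derivatives at the single point \<open>p\<close> replaces continuity of the second ones.
\<close>

lemma pderiv_at_commute:
  fixes f :: "real^'k \<Rightarrow> real"
  assumes "open W" "p \<in> W" "\<And>q. q \<in> W \<Longrightarrow> f differentiable (at q)"
    and "pderiv_at i f differentiable (at p)" "pderiv_at j f differentiable (at p)"
  shows "pderiv_at j (pderiv_at i f) p = pderiv_at i (pderiv_at j f) p"
proof (rule ccontr)
  define a where "a = pderiv_at j (pderiv_at i f) p"
  define b where "b = pderiv_at i (pderiv_at j f) p"
  assume "\<not> ?thesis"
  then have pos: "\<bar>a - b\<bar> / 4 > 0"
    by (simp add: a_def b_def)
  define \<Delta> where "\<Delta> t = f (p + t *\<^sub>R axis i 1 + t *\<^sub>R axis j 1) - f (p + t *\<^sub>R axis i 1)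
      - f (p + t *\<^sub>R axis j 1) + f p" for t
  obtain \<delta>1 where "\<delta>1 > 0" and 1: "\<And>t. 0 < t \<Longrightarrow> t < \<delta>1 \<Longrightarrow> \<bar>\<Delta> t - t\<^sup>2 * a\<bar> \<le> \<bar>a - b\<bar> / 4 * t\<^sup>2"
    using second_difference_bound[OF assms(1-3,4) pos, of j] unfolding \<Delta>_def a_def by blast
  obtain \<delta>2 where "\<delta>2 > 0" and 2: "\<And>t. 0 < t \<Longrightarrow> t < \<delta>2 \<Longrightarrow> \<bar>\<Delta> t - t\<^sup>2 * b\<bar> \<le> \<bar>a - b\<bar> / 4 * t\<^sup>2"
    using second_difference_bound[OF assms(1-3,5) pos, of i] unfolding \<Delta>_def b_def
    by (simp add: algebra_simps) blast
  define t where "t = min \<delta>1 \<delta>2 / 2"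
  have t: "0 < t" "t < \<delta>1" "t < \<delta>2"
    using \<open>\<delta>1 > 0\<close> \<open>\<delta>2 > 0\<close> by (auto simp: t_def)
  have "\<bar>t\<^sup>2 * a - t\<^sup>2 * b\<bar> \<le> \<bar>a - b\<bar> / 2 * t\<^sup>2"
    using 1[OF t(1,2)] 2[OF t(1,3)] by linarith
  moreover have "\<bar>t\<^sup>2 * a - t\<^sup>2 * b\<bar> = \<bar>a - b\<bar> * t\<^sup>2"
    by (metis abs_mult abs_power2 mult.commute right_diff_distrib)
  moreover have "\<bar>a - b\<bar> * t\<^sup>2 > 0"
    using t(1) pos by simp
  ultimately show False
    by simp
qed


section \<open>Twice differentiable functions\<close>

text \<open>
  Weaker than twice continuously differentiable, but enough for mixed derivatives to commute, and
  its closure under sums and products only needs the corresponding rules for first derivatives.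
\<close>

definition twice_diff_on :: "(real^'k) set \<Rightarrow> (real^'k \<Rightarrow> real) \<Rightarrow> bool" where
  "twice_diff_on W f \<longleftrightarrow> (\<forall>q\<in>W. f differentiable (at q) \<and> (\<forall>i. pderiv_at i f differentiable (at q)))"

lemma twice_diff_onD:
  assumes "twice_diff_on W f" "q \<in> W"
  shows "f differentiable (at q)" "pderiv_at i f differentiable (at q)"
  using assms by (auto simp: twice_diff_on_def)

lemma smooth_on_imp_twice_diff_on:
  assumes "open U" "smooth_on U f"
  shows "twice_diff_on U f"
proof -
  have "Ck_on (Suc (Suc 0)) U f"
    using assms(2) unfolding smooth_on_def by blast
  then show ?thesis
    using assms(1) by (auto simp: twice_diff_on_def differentiable_on_eq_differentiable_at)
qed

lemma twice_diff_on_commute: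
  assumes "open W" "twice_diff_on W f" "q \<in> W"
  shows "pderiv_at j (pderiv_at i f) q = pderiv_at i (pderiv_at j f) q"
  using assms by (intro pderiv_at_commute[OF assms(1,3)]) (auto simp: twice_diff_on_def)

lemma twice_diff_on_const:
  fixes W :: "(real^'k) set"
  shows "twice_diff_on W (\<lambda>q. c)"
proof -
  have "pderiv_at i (\<lambda>q. c) = (\<lambda>q. 0)" for i :: 'k
    by (simp add: fun_eq_iff)
  then show ?thesis
    by (simp add: twice_diff_on_def)
qed

lemma twice_diff_on_add:
  assumes "open W" "twice_diff_on W f" "twice_diff_on W g"
  shows "twice_diff_on W (\<lambda>q. f q + g q)"
  unfolding twice_diff_on_def
proof safe
  fix q i assume q: "q \<in> W"
  show "(\<lambda>q. f q + g q) differentiable at q"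
    using assms q by (simp add: twice_diff_on_def)
  have "(\<lambda>p. pderiv_at i f p + pderiv_at i g p) differentiable at q"
    using assms q by (simp add: twice_diff_on_def)
  then show "pderiv_at i (\<lambda>q. f q + g q) differentiable at q"
    by (rule differentiable_cong_open[OF assms(1) q, rotated])
      (use assms in \<open>simp add: pderiv_at_add twice_diff_on_def\<close>)
qed

lemma twice_diff_on_mult:
  assumes "open W" "twice_diff_on W f" "twice_diff_on W g"
  shows "twice_diff_on W (\<lambda>q. f q * g q)"
  unfolding twice_diff_on_def
proof safe
  fix q i assume q: "q \<in> W"
  show "(\<lambda>q. f q * g q) differentiable at q"
    using assms q by (simp add: twice_diff_on_def)
  have "(\<lambda>p. pderiv_at i f p * g p + f p * pderiv_at i g p) differentiable at q"
    using assms q by (simp add: twice_diff_on_def)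
  then show "pderiv_at i (\<lambda>q. f q * g q) differentiable at q"
    by (rule differentiable_cong_open[OF assms(1) q, rotated])
      (use assms in \<open>simp add: pderiv_at_mult twice_diff_on_def\<close>)
qed

lemma twice_diff_on_sum:
  fixes f :: "'i::finite \<Rightarrow> real^'k \<Rightarrow> real"
  assumes "open W" "\<And>i. twice_diff_on W (f i)"
  shows "twice_diff_on W (\<lambda>q. \<Sum>i\<in>UNIV. f i q)"
proof -
  have "twice_diff_on W (\<lambda>q. \<Sum>i\<in>A. f i q)" for A
    using finite[of A] by induction (simp_all add: twice_diff_on_const twice_diff_on_add assms)
  then show ?thesis .
qed


section \<open>Functions of the position that ignore the actuated variables\<close>

lemma sum_UNIV_Plus:
  "(\<Sum>k\<in>(UNIV::('n::finite + 'm::finite) set). f k) = (\<Sum>\<alpha>\<in>UNIV. f (Inl \<alpha>)) + (\<Sum>a\<in>UNIV. f (Inr a))"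
  by (simp add: UNIV_Plus_UNIV[symmetric] sum.Plus del: UNIV_Plus_UNIV)

lemma bounded_linear_xpart: "bounded_linear (xpart :: real^('n::finite + 'm::finite) \<Rightarrow> _)"
  by (intro linear_conv_bounded_linear[THEN iffD1] linearI) (simp_all add: xpart_def vec_eq_iff)

lemma xpart_axis_Inl [simp]:
  "xpart (q + t *\<^sub>R axis (Inl \<alpha>) 1 :: real^('n::finite + 'm::finite)) = xpart q + t *\<^sub>R axis \<alpha> 1"
  by (simp add: xpart_def vec_eq_iff axis_def)

lemma xpart_axis_Inr [simp]:
  "xpart (q + t *\<^sub>R axis (Inr a) 1 :: real^('n::finite + 'm::finite)) = xpart q"
  by (simp add: xpart_def vec_eq_iff axis_def)

lemma pderiv_at_Inl_xpart:
  "pderiv_at (Inl \<alpha>) (\<lambda>q::real^('n::finite + 'm::finite). f (xpart q)) q = pderiv_at \<alpha> f (xpart q)"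
  by (simp add: pderiv_at_def)

lemma pderiv_at_Inr_xpart:
  "pderiv_at (Inr a) (\<lambda>q::real^('n::finite + 'm::finite). f (xpart q)) q = 0"
  by (simp add: pderiv_at_def)

lemma differentiable_xpart:
  fixes q :: "real^('n::finite + 'm::finite)"
  assumes "f differentiable (at (xpart q))"
  shows "(\<lambda>q. f (xpart q)) differentiable (at q)"
  using differentiable_chain_at
      [OF bounded_linear_imp_differentiable[OF bounded_linear_xpart], of f q] assms
  by (simp add: o_def)

lemma twice_diff_on_xpart:
  assumes "twice_diff_on U f"
  shows "twice_diff_on (xpart -` U) (\<lambda>q::real^('n::finite + 'm::finite). f (xpart q))"
  unfolding twice_diff_on_def
proof safe
  fix q :: "real^('n + 'm)" and i assume q: "xpart q \<in> U"
  show "(\<lambda>q::real^('n + 'm). f (xpart q)) differentiable at q"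
    using assms q by (intro differentiable_xpart) (simp add: twice_diff_on_def)
  show "pderiv_at i (\<lambda>q::real^('n + 'm). f (xpart q)) differentiable at q"
  proof (cases i)
    case (Inl \<alpha>)
    have "pderiv_at i (\<lambda>q::real^('n + 'm). f (xpart q)) = (\<lambda>q. pderiv_at \<alpha> f (xpart q))"
      by (simp add: Inl fun_eq_iff pderiv_at_Inl_xpart)
    then show ?thesis
      using assms q by (simp add: differentiable_xpart twice_diff_on_def)
  next
    case (Inr a)
    have "pderiv_at i (\<lambda>q::real^('n + 'm). f (xpart q)) = (\<lambda>q. 0)"
      by (simp add: Inr fun_eq_iff pderiv_at_Inr_xpart)
    then show ?thesis
      by simp
  qed
qed

lemma open_xpart_vimage: "open U \<Longrightarrow> open (xpart -` U :: (real^('n::finite + 'm::finite)) set)"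
  by (intro continuous_open_vimage) (simp_all add: linear_continuous_at bounded_linear_xpart)


section \<open>Total time derivatives of functions linear in the velocity\<close>

text \<open>
  The expanded time derivative of \<open>\<Sum>\<^sub>j c\<^sub>j(q) v\<^sub>j\<close>. Momenta and Legendre components all have this form.
\<close>

definition dt_lin :: "('k \<Rightarrow> real^'k \<Rightarrow> real) \<Rightarrow> real^'k \<Rightarrow> real^'k \<Rightarrow> real^'k \<Rightarrow> real" where
  "dt_lin c q v w = (\<Sum>k\<in>UNIV. \<Sum>j\<in>UNIV. pderiv_at k (c j) q * v $ j * v $ k)
     + (\<Sum>j\<in>UNIV. c j q * w $ j)"

lemma pderiv_at_lin_pos:
  assumes "\<And>j. c j differentiable (at q)"
  shows "pderiv_at k (\<lambda>q'. \<Sum>j\<in>UNIV. c j q' * v $ j) q = (\<Sum>j\<in>UNIV. pderiv_at k (c j) q * v $ j)"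
  by (subst pderiv_at_sum) (simp_all add: assms pderiv_at_multc)

lemma time_deriv_lin:
  assumes "open W" "q \<in> W" and c: "\<And>j. c j differentiable (at q)"
    and G: "\<And>q v. q \<in> W \<Longrightarrow> G q v = (\<Sum>j\<in>UNIV. c j q * v $ j)"
  shows "time_deriv G q v w = dt_lin c q v w"
proof -
  have "pderiv_at k (\<lambda>q'. G q' v) q = (\<Sum>j\<in>UNIV. pderiv_at k (c j) q * v $ j)" for k
    by (subst pderiv_at_lin_pos[OF c, symmetric], rule pderiv_at_cong_open[OF assms(1,2)]) (rule G)
  then show ?thesis
    using assms(2) by (simp add: time_deriv_def dt_lin_def G pderiv_at_linear sum_distrib_right)
qed

lemma dt_lin_cong_open:
  assumes "open W" "q \<in> W" "\<And>j q. q \<in> W \<Longrightarrow> c j q = d j q"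
  shows "dt_lin c q v w = dt_lin d q v w"
proof -
  have "pderiv_at k (c j) q = pderiv_at k (d j) q" for k j
    by (rule pderiv_at_cong_open[OF assms(1,2)]) (rule assms(3))
  then show ?thesis
    by (simp add: dt_lin_def assms(2,3))
qed

lemma dt_lin_add:
  assumes "\<And>j. c j differentiable (at q)" "\<And>j. d j differentiable (at q)"
  shows "dt_lin (\<lambda>j q. c j q + d j q) q v w = dt_lin c q v w + dt_lin d q v w"
  by (simp add: dt_lin_def pderiv_at_add assms sum.distrib algebra_simps)

lemma dt_lin_sum:
  fixes c :: "'i::finite \<Rightarrow> 'k \<Rightarrow> real^'k \<Rightarrow> real"
  assumes "\<And>a j. c a j differentiable (at q)"
  shows "dt_lin (\<lambda>j q. \<Sum>a\<in>UNIV. c a j q) q v w = (\<Sum>a\<in>UNIV. dt_lin (c a) q v w)"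
proof -
  have "dt_lin (\<lambda>j q. \<Sum>a\<in>UNIV. c a j q) q v w
      = (\<Sum>k\<in>UNIV. \<Sum>j\<in>UNIV. \<Sum>a\<in>UNIV. pderiv_at k (c a j) q * v $ j * v $ k)
        + (\<Sum>j\<in>UNIV. \<Sum>a\<in>UNIV. c a j q * w $ j)"
    by (simp add: dt_lin_def pderiv_at_sum assms sum_distrib_right)
  also have "(\<Sum>k\<in>UNIV. \<Sum>j\<in>UNIV. \<Sum>a\<in>UNIV. pderiv_at k (c a j) q * v $ j * v $ k)
      = (\<Sum>a\<in>UNIV. \<Sum>k\<in>UNIV. \<Sum>j\<in>UNIV. pderiv_at k (c a j) q * v $ j * v $ k)"
  proof -
    have "(\<Sum>k\<in>UNIV. \<Sum>j\<in>UNIV. \<Sum>a\<in>UNIV. pderiv_at k (c a j) q * v $ j * v $ k)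
        = (\<Sum>k\<in>UNIV. \<Sum>a\<in>UNIV. \<Sum>j\<in>UNIV. pderiv_at k (c a j) q * v $ j * v $ k)"
      by (intro sum.cong refl sum.swap)
    also have "\<dots> = (\<Sum>a\<in>UNIV. \<Sum>k\<in>UNIV. \<Sum>j\<in>UNIV. pderiv_at k (c a j) q * v $ j * v $ k)"
      by (rule sum.swap)
    finally show ?thesis .
  qed
  also have "(\<Sum>j\<in>UNIV. \<Sum>a\<in>UNIV. c a j q * w $ j) = (\<Sum>a\<in>UNIV. \<Sum>j\<in>UNIV. c a j q * w $ j)"
    by (rule sum.swap)
  finally show ?thesis
    by (simp add: dt_lin_def sum.distrib)
qed

lemma dt_lin_mult:
  assumes "f differentiable (at q)" "\<And>j. c j differentiable (at q)"
  shows "dt_lin (\<lambda>j q. f q * c j q) q v w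
    = (\<Sum>k\<in>UNIV. pderiv_at k f q * v $ k) * (\<Sum>j\<in>UNIV. c j q * v $ j) + f q * dt_lin c q v w"
proof -
  have "(\<Sum>k\<in>UNIV. pderiv_at k f q * v $ k) * (\<Sum>j\<in>UNIV. c j q * v $ j)
      = (\<Sum>k\<in>UNIV. \<Sum>j\<in>UNIV. pderiv_at k f q * c j q * v $ j * v $ k)"
    unfolding sum_product by (intro sum.cong refl) (simp add: mult_ac)
  then show ?thesis
    by (simp add: dt_lin_def pderiv_at_mult assms algebra_simps sum.distrib sum_distrib_left)
qed

lemma differentiable_dt_lin:
  assumes "\<And>j. twice_diff_on W (c j)" "q \<in> W"
  shows "(\<lambda>q. dt_lin c q v w) differentiable (at q)"
  unfolding dt_lin_def
  by (intro differentiable_add differentiable_sum_finite differentiable_mult differentiable_const)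
    (use assms in \<open>simp_all add: twice_diff_on_def\<close>)

lemma pderiv_at_vel_dt_lin:
  "pderiv_at l (\<lambda>v. dt_lin c q v w) v
     = (\<Sum>k\<in>UNIV. pderiv_at k (c l) q * v $ k) + (\<Sum>j\<in>UNIV. pderiv_at l (c j) q * v $ j)"
proof -
  have "pderiv_at l (\<lambda>v. dt_lin c q v w) v
      = pderiv_at l (\<lambda>v. \<Sum>k\<in>UNIV. \<Sum>j\<in>UNIV. pderiv_at k (c j) q * v $ j * v $ k) v"
    unfolding dt_lin_def
    by (subst pderiv_at_add)
      (intro differentiable_sum_finite differentiable_mult differentiable_vec_nth
        differentiable_const | simp)+
  then show ?thesis
    unfolding pderiv_at_quadratic by (simp add: algebra_simps sum.distrib)
qed

lemma pderiv_at_acc_dt_lin: "pderiv_at l (\<lambda>w. dt_lin c q v w) w = c l q"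
  unfolding dt_lin_def
  by (subst pderiv_at_add)
    (intro differentiable_sum_finite differentiable_mult differentiable_vec_nth
        differentiable_const | simp add: pderiv_at_linear)+


section \<open>Symmetric and positive definite matrices\<close>

lemma matrix_inv_cancel:
  fixes A :: "real^'k^'k"
  assumes "invertible A"
  shows "A ** matrix_inv A = mat 1" "matrix_inv A ** A = mat 1"
  using assms unfolding invertible_def matrix_inv_def
  by (metis (mono_tags, lifting) someI_ex)+

lemma pos_def_matrix_block_invertible:
  fixes A :: "real^('n::finite + 'm::finite)^('n + 'm)"
  assumes "pos_def_matrix A"
  shows "invertible (\<chi> a b. A $ Inr a $ Inr b)"
proof -
  let ?B = "\<chi> a b. A $ Inr a $ Inr b"
  have "v = 0" if v: "?B *v v = 0" for v
  proof (rule ccontr)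
    assume "v \<noteq> 0"
    \<comment> \<open>extend the kernel vector by zero to test positivity of the full matrix\<close>
    define u :: "real^('n + 'm)" where "u = (\<chi> i. case i of Inl \<alpha> \<Rightarrow> 0 | Inr a \<Rightarrow> v $ a)"
    have "u \<noteq> 0"
      using \<open>v \<noteq> 0\<close> by (auto simp: u_def vec_eq_iff split: sum.splits)
    moreover have "u \<bullet> (A *v u) = v \<bullet> (?B *v v)"
      by (simp add: inner_vec_def matrix_vector_mult_def sum_UNIV_Plus u_def)
    ultimately show False
      using assms v by (auto simp: pos_def_matrix_def)
  qed
  then show ?thesis
    using matrix_left_invertible_ker[of ?B] invertible_left_inverse[of ?B] by blast
qed

lemma inner_symmetric_matrix:
  fixes A :: "real^'k^'k"
  assumes "transpose A = A"
  shows "(A *v x) \<bullet> y = x \<bullet> (A *v y)"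
  by (metis assms dot_lmul_matrix transpose_matrix_vector)

lemma matrix_inv_symmetric:
  fixes A :: "real^'k^'k"
  assumes "invertible A" "transpose A = A"
  shows "transpose (matrix_inv A) = matrix_inv A"
  by (metis assms matrix_inv_cancel matrix_mul_assoc matrix_mul_lid matrix_mul_rid
      matrix_transpose_mul transpose_mat)

lemma matrix_mult_scaleR_right: "A ** (c *\<^sub>R B) = c *\<^sub>R (A ** B)" for A B :: "real^'k^'k"
  by (simp add: vec_eq_iff matrix_matrix_mult_def sum_distrib_left mult_ac)

lemma matrix_vector_sum_scaleR:
  fixes A :: "real^'k^'k"
  shows "A *v (\<Sum>i\<in>I. c i *\<^sub>R x i) = (\<Sum>i\<in>I. c i *\<^sub>R (A *v x i))"
  by (simp add: linear_sum[OF matrix_vector_mul_linear] linear_scale[OF matrix_vector_mul_linear])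


section \<open>The controlled system in coordinates\<close>

text \<open>
  From here on all coefficients are regarded as functions of the full position \<open>q\<close>, so that one
  sum over all coordinates replaces separate sums over \<open>x\<close> and \<open>\<theta>\<close>; derivatives in the directions
  \<open>Inr a\<close> vanish.
\<close>

locale controlled_system =
  fixes U :: "(real^'n::finite) set"
    and g :: "real^'n \<Rightarrow> real^('n + 'm::finite)^('n + 'm)"
    and V :: "real^'n \<Rightarrow> real"
    and \<tau> :: "real^'n \<Rightarrow> real^'n^'m"
    and \<sigma> :: "real^'n \<Rightarrow> real^'m^'m"
  assumes open_U: "open U"
    and twice_diff_g: "\<And>i j. twice_diff_on U (\<lambda>x. g x $ i $ j)"
    and twice_diff_V: "twice_diff_on U V"
    and twice_diff_\<tau>: "\<And>a \<alpha>. twice_diff_on U (\<lambda>x. \<tau> x $ a $ \<alpha>)"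
    and twice_diff_\<sigma>: "\<And>a b. twice_diff_on U (\<lambda>x. \<sigma> x $ a $ b)"
    and pos_def_g: "\<And>x. x \<in> U \<Longrightarrow> pos_def_matrix (g x)"
    and sym_\<sigma>: "\<And>x. x \<in> U \<Longrightarrow> transpose (\<sigma> x) = \<sigma> x"
    and invertible_C:
      "\<And>q v w. xpart q \<in> U \<Longrightarrow> invertible (acc_matrix (controlled_EL g V \<tau>) q v w)"
begin

abbreviation "\<Phi> \<equiv> controlled_EL g V \<tau>"
abbreviation "F \<equiv> controlled_F g \<tau> \<sigma>"

definition W :: "(real^('n + 'm)) set" where "W = xpart -` U"

definition gq :: "'n + 'm \<Rightarrow> 'n + 'm \<Rightarrow> real^('n + 'm) \<Rightarrow> real" where
  "gq i j q = g (xpart q) $ i $ j"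

definition \<tau>q :: "'m \<Rightarrow> 'n \<Rightarrow> real^('n + 'm) \<Rightarrow> real" where
  "\<tau>q a \<alpha> q = \<tau> (xpart q) $ a $ \<alpha>"

definition \<sigma>q :: "'m \<Rightarrow> 'm \<Rightarrow> real^('n + 'm) \<Rightarrow> real" where
  "\<sigma>q a b q = \<sigma> (xpart q) $ a $ b"

text \<open>
  The actuated rows shared by the Legendre matrix \<open>leg\<close> of \<open>F\<close> and the acceleration matrix \<open>cmat\<close>
  of \<open>\<Phi>\<close>; the two matrices differ in their unactuated rows only.
\<close>

definition act_leg :: "'m \<Rightarrow> 'n + 'm \<Rightarrow> real^('n + 'm) \<Rightarrow> real" where
  "act_leg a j q = (case j of
     Inl \<alpha> \<Rightarrow> gq (Inl \<alpha>) (Inr a) q + (\<Sum>d\<in>UNIV. gq (Inr d) (Inr a) q * \<tau>q d \<alpha> q)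
   | Inr b \<Rightarrow> gq (Inr a) (Inr b) q)"

definition leg :: "'n + 'm \<Rightarrow> 'n + 'm \<Rightarrow> real^('n + 'm) \<Rightarrow> real" where
  "leg i j q = (case i of
     Inl \<alpha> \<Rightarrow> (case j of
       Inl \<beta> \<Rightarrow> gq (Inl \<alpha>) (Inl \<beta>) q
           + (\<Sum>a\<in>UNIV. gq (Inl \<alpha>) (Inr a) q * \<tau>q a \<beta> q)
           + (\<Sum>a\<in>UNIV. gq (Inl \<beta>) (Inr a) q * \<tau>q a \<alpha> q)
           + (\<Sum>a\<in>UNIV. \<Sum>b\<in>UNIV. gq (Inr a) (Inr b) q * \<tau>q a \<alpha> q * \<tau>q b \<beta> q)
           + (\<Sum>a\<in>UNIV. \<Sum>b\<in>UNIV. \<sigma>q a b q * \<tau>q a \<alpha> q * \<tau>q b \<beta> q)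
     | Inr b \<Rightarrow> act_leg b (Inl \<alpha>) q)
   | Inr a \<Rightarrow> act_leg a j q)"

definition cmat :: "'n + 'm \<Rightarrow> 'n + 'm \<Rightarrow> real^('n + 'm) \<Rightarrow> real" where
  "cmat i j q = (case i of Inl \<alpha> \<Rightarrow> gq (Inl \<alpha>) j q | Inr a \<Rightarrow> act_leg a j q)"

definition dL :: "'n + 'm \<Rightarrow> real^('n + 'm) \<Rightarrow> real^('n + 'm) \<Rightarrow> real" where
  "dL i q v = pderiv_at i (\<lambda>q'. lagrangian g V q' v) q"

lemma W_iff: "q \<in> W \<longleftrightarrow> xpart q \<in> U"
  by (simp add: W_def)

lemma open_W: "open W"
  unfolding W_def by (rule open_xpart_vimage[OF open_U])

lemma gq_sym: "q \<in> W \<Longrightarrow> gq i j q = gq j i q"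
  using pos_def_g[of "xpart q"] by (simp add: W_iff gq_def pos_def_matrix_def transpose_def vec_eq_iff)

lemma \<sigma>q_sym: "q \<in> W \<Longrightarrow> \<sigma>q a b q = \<sigma>q b a q"
  using sym_\<sigma>[of "xpart q"] by (simp add: W_iff \<sigma>q_def transpose_def vec_eq_iff)

lemma twice_diff_gq: "twice_diff_on W (gq i j)"
  using twice_diff_on_xpart[OF twice_diff_g] by (simp add: W_def gq_def[abs_def])

lemma twice_diff_\<tau>q: "twice_diff_on W (\<tau>q a \<alpha>)"
  using twice_diff_on_xpart[OF twice_diff_\<tau>] by (simp add: W_def \<tau>q_def[abs_def])

lemma twice_diff_\<sigma>q: "twice_diff_on W (\<sigma>q a b)"
  using twice_diff_on_xpart[OF twice_diff_\<sigma>] by (simp add: W_def \<sigma>q_def[abs_def])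

lemma twice_diff_V': "twice_diff_on W (\<lambda>q. V (xpart q))"
  using twice_diff_on_xpart[OF twice_diff_V] by (simp add: W_def)

lemmas twice_diff_intros = twice_diff_gq twice_diff_\<tau>q twice_diff_\<sigma>q twice_diff_V' twice_diff_on_const twice_diff_on_add[OF open_W] twice_diff_on_mult[OF open_W]
  twice_diff_on_sum[OF open_W]

lemma twice_diff_act_leg: "twice_diff_on W (act_leg a j)"
  by (cases j) (simp_all add: act_leg_def[abs_def] twice_diff_intros)

lemma twice_diff_leg: "twice_diff_on W (leg i j)"
  by (cases i; cases j) (simp_all add: leg_def[abs_def] twice_diff_act_leg twice_diff_intros)

lemma twice_diff_cmat: "twice_diff_on W (cmat i j)"
  by (cases i) (simp_all add: cmat_def[abs_def] twice_diff_act_leg twice_diff_intros)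

lemmas diff_gq = twice_diff_onD(1)[OF twice_diff_gq] and diff_\<tau>q = twice_diff_onD(1)[OF twice_diff_\<tau>q] and diff_\<sigma>q = twice_diff_onD(1)[OF twice_diff_\<sigma>q]
  and diff_act_leg = twice_diff_onD(1)[OF twice_diff_act_leg]
  and diff_leg = twice_diff_onD(1)[OF twice_diff_leg] and diff_cmat = twice_diff_onD(1)[OF twice_diff_cmat]

lemma actuated_shift:
  "gq i j (q + x *\<^sub>R axis (Inr a) 1) = gq i j q" "\<tau>q b \<alpha> (q + x *\<^sub>R axis (Inr a) 1) = \<tau>q b \<alpha> q"
  "\<sigma>q b c (q + x *\<^sub>R axis (Inr a) 1) = \<sigma>q b c q"
  by (simp_all add: gq_def \<tau>q_def \<sigma>q_def)

lemma pderiv_Inr_zero [simp]: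
  "pderiv_at (Inr a) (gq i j) q = 0" "pderiv_at (Inr a) (\<tau>q b \<alpha>) q = 0"
  "pderiv_at (Inr a) (act_leg b j) q = 0" "pderiv_at (Inr a) (leg i j) q = 0"
  by (cases i; cases j; simp add: pderiv_at_def actuated_shift act_leg_def leg_def)+

lemma leg_Inr: "leg (Inr a) j = act_leg a j"
  by (simp add: leg_def fun_eq_iff)

lemma cmat_simps: "cmat (Inl \<alpha>) j = gq (Inl \<alpha>) j" "cmat (Inr a) j = act_leg a j"
  by (simp_all add: cmat_def fun_eq_iff)

lemma leg_sym:
  assumes "q \<in> W"
  shows "leg i j q = leg j i q"
proof (cases i; cases j)
  fix \<alpha> \<beta> assume ij: "i = Inl \<alpha>" "j = Inl \<beta>"
  have "(\<Sum>a\<in>UNIV. \<Sum>b\<in>UNIV. c a b q * \<tau>q a \<alpha> q * \<tau>q b \<beta> q) = (\<Sum>a\<in>UNIV. \<Sum>b\<in>UNIV. c a b q * \<tau>q a \<beta> q * \<tau>q b \<alpha> q)"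
    if "\<And>a b. c a b q = c b a q" for c
    by (subst sum.swap, intro sum.cong refl) (metis mult.assoc mult.commute that)
  from this[of "\<lambda>a b. gq (Inr a) (Inr b)"] this[of \<sigma>q] show ?thesis
    using assms by (simp add: ij leg_def gq_sym[OF assms] \<sigma>q_sym[OF assms])
qed (use gq_sym[OF assms] in \<open>simp_all add: leg_def act_leg_def\<close>)

lemma F_lin: "F i q v = (\<Sum>j\<in>UNIV. leg i j q * v $ j)"
  by (cases i)
    (simp_all add: controlled_F_def Let_def sum_UNIV_Plus leg_def act_leg_def gq_def \<tau>q_def \<sigma>q_def)

text \<open>
  The symmetry of the metric, which holds over \<open>U\<close> only, merges the two mixed blocks. All formulas for
  \<open>\<Phi>\<close> are therefore restricted to \<open>W\<close>, and are differentiated there because \<open>W\<close> is open.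
\<close>

lemma lagrangian_eq:
  assumes "q \<in> W"
  shows "lagrangian g V q v
    = 1/2 * (\<Sum>i\<in>UNIV. \<Sum>j\<in>UNIV. gq i j q * v $ j * v $ i) - V (xpart q)"
proof -
  have "(\<Sum>a\<in>UNIV. \<Sum>\<beta>\<in>UNIV. gq (Inr a) (Inl \<beta>) q * v $ Inl \<beta> * v $ Inr a)
      = (\<Sum>\<alpha>\<in>UNIV. \<Sum>a\<in>UNIV. gq (Inl \<alpha>) (Inr a) q * v $ Inl \<alpha> * v $ Inr a)"
    by (subst sum.swap) (simp add: gq_sym[OF assms, of "Inr _" "Inl _"])
  then show ?thesis
    by (simp add: lagrangian_def Let_def sum_UNIV_Plus gq_def[symmetric] sum.distrib mult_ac)
qed

lemma momentum_eq:
  assumes "q \<in> W"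
  shows "pderiv_at i (\<lambda>v. lagrangian g V q v) v = (\<Sum>j\<in>UNIV. gq i j q * v $ j)"
proof -
  have "pderiv_at i (\<lambda>v. lagrangian g V q v) v
      = 1/2 * pderiv_at i (\<lambda>v. \<Sum>i\<in>UNIV. \<Sum>j\<in>UNIV. gq i j q * v $ j * v $ i) v"
    unfolding lagrangian_eq[OF assms]
    by (subst pderiv_at_diff, (intro differentiable_sum_finite differentiable_mult differentiable_vec_nth
        differentiable_const)+, subst pderiv_at_cmult)
      ((intro differentiable_sum_finite differentiable_mult differentiable_vec_nth
        differentiable_const)+, simp)
  then show ?thesis
    unfolding pderiv_at_quadratic
    by (simp add: gq_sym[OF assms, of _ i] sum_distrib_left sum_divide_distrib)
qed

text \<open>
  The potential enters with a factor \<open>-1\<close> rather than with a subtraction so that sums and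
  products are the only operations involved.
\<close>

lemma twice_diff_lagrangian: "twice_diff_on W (\<lambda>q. 1/2 * (\<Sum>i\<in>UNIV. \<Sum>j\<in>UNIV. gq i j q * v $ j * v $ i) + (-1) * V (xpart q))"
  by (intro twice_diff_intros)

lemma dL_eq_kinetic:
  assumes "q \<in> W"
  shows "dL i q v = pderiv_at i (\<lambda>q. 1/2 * (\<Sum>i\<in>UNIV. \<Sum>j\<in>UNIV. gq i j q * v $ j * v $ i) + (-1) * V (xpart q)) q"
  unfolding dL_def by (rule pderiv_at_cong_open[OF open_W assms]) (simp add: lagrangian_eq)

lemma dL_Inr [simp]: "dL (Inr a) q v = 0"
  by (simp add: dL_def pderiv_at_def lagrangian_def Let_def)

lemma dL_eq:
  assumes "q \<in> W"
  shows "dL i q v = 1/2 * (\<Sum>k\<in>UNIV. \<Sum>j\<in>UNIV. pderiv_at i (gq k j) q * v $ j * v $ k)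
    - pderiv_at i (\<lambda>q. V (xpart q)) q"
proof -
  have "dL i q v = 1/2 * pderiv_at i (\<lambda>q. \<Sum>i\<in>UNIV. \<Sum>j\<in>UNIV. gq i j q * v $ j * v $ i) q
      + (-1) * pderiv_at i (\<lambda>q. V (xpart q)) q"
    unfolding dL_eq_kinetic[OF assms]
    by (subst pderiv_at_add, intro twice_diff_onD(1)[OF _ assms] twice_diff_intros, intro twice_diff_onD(1)[OF _ assms] twice_diff_intros,
        subst pderiv_at_cmult, intro twice_diff_onD(1)[OF _ assms] twice_diff_intros,
        subst pderiv_at_cmult, intro twice_diff_onD(1)[OF _ assms] twice_diff_intros, rule refl)
  also have "pderiv_at i (\<lambda>q. \<Sum>i\<in>UNIV. \<Sum>j\<in>UNIV. gq i j q * v $ j * v $ i) q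
      = (\<Sum>k\<in>UNIV. \<Sum>j\<in>UNIV. pderiv_at i (gq k j) q * v $ j * v $ k)"
    by (simp add: pderiv_at_sum pderiv_at_multc diff_gq[OF assms] differentiable_sum_finite)
  finally show ?thesis
    by simp
qed

lemma differentiable_dL:
  assumes "q \<in> W"
  shows "(\<lambda>q. dL i q v) differentiable (at q)"
  by (rule differentiable_cong_open[OF open_W assms dL_eq_kinetic twice_diff_onD(2)[OF twice_diff_lagrangian assms]])

text \<open>
  Mixed second derivatives of the Lagrangian are what the Euler-Lagrange expression itself
  contributes to \<open>(AA)\<^sub>\<alpha>\<^sub>\<beta>\<close>.
\<close>

lemma dL_commute:
  assumes "q \<in> W"
  shows "pderiv_at j (\<lambda>q. dL i q v) q = pderiv_at i (\<lambda>q. dL j q v) q"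
  using twice_diff_on_commute[OF open_W twice_diff_lagrangian assms, of j i v]
  by (simp add: pderiv_at_cong_open[OF open_W assms dL_eq_kinetic])

lemma pderiv_gq_sym:
  assumes "q \<in> W"
  shows "pderiv_at k (gq i j) q = pderiv_at k (gq j i) q"
  by (rule pderiv_at_cong_open[OF open_W assms]) (rule gq_sym)

lemma pderiv_at_vel_dL:
  assumes "q \<in> W"
  shows "pderiv_at l (\<lambda>v. dL i q v) v = (\<Sum>j\<in>UNIV. pderiv_at i (gq l j) q * v $ j)"
proof -
  have "pderiv_at l (\<lambda>v. dL i q v) v
      = 1/2 * pderiv_at l (\<lambda>v. \<Sum>k\<in>UNIV. \<Sum>j\<in>UNIV. pderiv_at i (gq k j) q * v $ j * v $ k) v"
    unfolding dL_eq[OF assms]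
    by (subst pderiv_at_diff, (intro differentiable_sum_finite differentiable_mult differentiable_vec_nth
        differentiable_const)+, subst pderiv_at_cmult)
      ((intro differentiable_sum_finite differentiable_mult differentiable_vec_nth
        differentiable_const)+, simp)
  then show ?thesis
    unfolding pderiv_at_quadratic
    by (simp add: pderiv_gq_sym[OF assms, of _ _ l] sum_distrib_left sum_divide_distrib)
qed

text \<open>
  A single formula covers both kinds of index, since \<open>dL\<close> vanishes for actuated ones.
\<close>

lemma Phi_eq:
  assumes "q \<in> W"
  shows "\<Phi> i q v w = dt_lin (cmat i) q v w - dL i q v"
proof (cases i)
  case (Inl \<alpha>)
  have "time_deriv (\<lambda>q v. pderiv_at (Inl \<alpha>) (\<lambda>v. lagrangian g V q v) v) q v w
      = dt_lin (cmat i) q v w"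
    by (rule time_deriv_lin[OF open_W assms diff_cmat[OF assms]])
      (simp add: Inl cmat_simps momentum_eq)
  then show ?thesis
    by (simp add: Inl controlled_EL_def dL_def)
next
  case (Inr a)
  have "time_deriv (\<lambda>q' v'. pderiv_at (Inr a) (\<lambda>v''. lagrangian g V q' v'') v'
         + (\<Sum>b\<in>UNIV. \<Sum>\<beta>\<in>UNIV. g (xpart q') $ Inr a $ Inr b * \<tau> (xpart q') $ b $ \<beta> * v' $ Inl \<beta>)) q v w
      = dt_lin (cmat i) q v w"
  proof (rule time_deriv_lin[OF open_W assms diff_cmat[OF assms]])
    fix q v :: "real^('n + 'm)" assume q: "q \<in> W"
    have "(\<Sum>b\<in>UNIV. \<Sum>\<beta>\<in>UNIV. gq (Inr a) (Inr b) q * \<tau>q b \<beta> q * v $ Inl \<beta>)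
        = (\<Sum>\<beta>\<in>UNIV. (\<Sum>b\<in>UNIV. gq (Inr b) (Inr a) q * \<tau>q b \<beta> q) * v $ Inl \<beta>)"
      by (subst sum.swap) (simp add: sum_distrib_right gq_sym[OF q, of "Inr a" "Inr _"])
    then show "pderiv_at (Inr a) (\<lambda>v''. lagrangian g V q v'') v
         + (\<Sum>b\<in>UNIV. \<Sum>\<beta>\<in>UNIV. g (xpart q) $ Inr a $ Inr b * \<tau> (xpart q) $ b $ \<beta> * v $ Inl \<beta>)
       = (\<Sum>j\<in>UNIV. cmat i j q * v $ j)"
      unfolding momentum_eq[OF q] gq_def[symmetric] \<tau>q_def[symmetric]
      by (simp add: Inr cmat_simps act_leg_def sum_UNIV_Plus sum.distrib distrib_right
          gq_sym[OF q, of "Inr a" "Inl _"])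
  qed
  then show ?thesis
    by (simp add: Inr controlled_EL_def)
qed

lemma differentiable_Phi:
  assumes "q \<in> W"
  shows "(\<lambda>q. \<Phi> i q v w) differentiable (at q)"
  by (rule differentiable_cong_open[OF open_W assms Phi_eq])
    (simp_all add: differentiable_dL[OF assms] differentiable_dt_lin[OF twice_diff_cmat assms])

lemma acc_matrix_eq:
  assumes "q \<in> W"
  shows "acc_matrix \<Phi> q v w = (\<chi> i j. cmat i j q)"
proof -
  have "pderiv_at j (\<lambda>w. dt_lin (cmat i) q v w - dL i q v) w = cmat i j q" for i j
  proof -
    have "(\<lambda>w. dt_lin (cmat i) q v w) differentiable at w"
      unfolding dt_lin_def
      by (intro differentiable_add differentiable_sum_finite differentiable_mult
          differentiable_vec_nth differentiable_const)
    then show ?thesis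
      by (simp add: pderiv_at_diff pderiv_at_acc_dt_lin)
  qed
  then show ?thesis
    by (simp add: acc_matrix_def Phi_eq[OF assms])
qed

lemma pderiv_at_vel_Phi:
  assumes "q \<in> W"
  shows "pderiv_at l (\<lambda>v. \<Phi> i q v w) v
     = (\<Sum>k\<in>UNIV. pderiv_at k (cmat i l) q * v $ k) + (\<Sum>k\<in>UNIV. pderiv_at l (cmat i k) q * v $ k)
       - (\<Sum>k\<in>UNIV. pderiv_at i (gq l k) q * v $ k)"
proof -
  have "(\<lambda>v. dt_lin (cmat i) q v w) differentiable at v" "(\<lambda>v. dL i q v) differentiable at v"
    unfolding dt_lin_def dL_eq[OF assms]
    by (intro differentiable_add differentiable_diff differentiable_sum_finite differentiable_mult
        differentiable_vec_nth differentiable_const)+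
  then show ?thesis
    unfolding Phi_eq[OF assms]
    by (simp add: pderiv_at_diff pderiv_at_vel_dt_lin pderiv_at_vel_dL[OF assms])
qed

text \<open>
  Row \<open>i\<close> of \<open>M C\<^sup>-\<^sup>1\<close> is \<open>R\<close> as soon as row \<open>i\<close> of \<open>M\<close> is \<open>R\<close> times \<open>C\<close>. This removes the
  inverse from all Helmholtz conditions.
\<close>

lemma C_inverse_contract:
  assumes "q \<in> W" and row: "\<And>k. leg i k q = (\<Sum>r\<in>UNIV. R r * cmat r k q)"
  shows "(\<Sum>k\<in>UNIV. \<Sum>r\<in>UNIV. pderiv_at k (\<lambda>v'. F i q v') v * X r
           * matrix_inv (acc_matrix \<Phi> q v w) $ k $ r) = (\<Sum>r\<in>UNIV. R r * X r)"
proof -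
  let ?C = "acc_matrix \<Phi> q v w"
  have C: "?C $ p $ k = cmat p k q" for p k
    by (simp add: acc_matrix_eq[OF assms(1)])
  have "(?C ** matrix_inv ?C) $ p $ r = (if p = r then 1 else 0)" for p r
    using matrix_inv_cancel(1)[OF invertible_C] assms(1) by (simp add: W_iff mat_def)
  then have inv: "(\<Sum>k\<in>UNIV. cmat p k q * matrix_inv ?C $ k $ r) = (if p = r then 1 else 0)" for p r
    by (simp add: matrix_matrix_mult_def C)
  have "(\<Sum>k\<in>UNIV. leg i k q * matrix_inv ?C $ k $ r) = R r" for r
  proof -
    have "(\<Sum>k\<in>UNIV. leg i k q * matrix_inv ?C $ k $ r)
        = (\<Sum>p\<in>UNIV. R p * (\<Sum>k\<in>UNIV. cmat p k q * matrix_inv ?C $ k $ r))"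
      unfolding row sum_distrib_right sum_distrib_left by (subst sum.swap) (simp add: mult.assoc)
    then show ?thesis
      by (simp add: inv if_distrib cong: if_cong)
  qed
  then have "(\<Sum>r\<in>UNIV. R r * X r)
      = (\<Sum>r\<in>UNIV. \<Sum>k\<in>UNIV. leg i k q * X r * matrix_inv ?C $ k $ r)"
    by (simp add: sum_distrib_right[symmetric] mult.assoc mult.commute[of "X _"])
       (simp add: mult.assoc[symmetric] sum_distrib_right[symmetric])
  then show ?thesis
    unfolding F_lin pderiv_at_linear by (subst sum.swap) simp
qed


section \<open>The Helmholtz conditions that hold identically\<close>

lemma helmholtz_B_holds:
  assumes "q \<in> W"
  shows "helmholtz_B F i j q v"
  unfolding helmholtz_B_def F_lin pderiv_at_linear by (rule leg_sym[OF assms])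

lemma pderiv_at_pos_F:
  assumes "q \<in> W"
  shows "pderiv_at k (\<lambda>q. F i q v) q = (\<Sum>l\<in>UNIV. pderiv_at k (leg i l) q * v $ l)"
  unfolding F_lin by (rule pderiv_at_lin_pos[OF diff_leg[OF assms]])

lemma helmholtz_AB_iff:
  assumes q: "q \<in> W" and row: "\<And>k. leg i k q = (\<Sum>r\<in>UNIV. R r * cmat r k q)"
  shows "helmholtz_AB \<Phi> F i j q v w \<longleftrightarrow>
    (\<Sum>k\<in>UNIV. pderiv_at k (leg i j) q * v $ k) + (\<Sum>k\<in>UNIV. pderiv_at j (leg i k) q * v $ k)
      - (\<Sum>k\<in>UNIV. pderiv_at i (leg j k) q * v $ k)
    = (\<Sum>r\<in>UNIV. R r * pderiv_at j (\<lambda>v. \<Phi> r q v w) v)"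
  unfolding helmholtz_AB_def
    C_inverse_contract[OF q row, where X = "\<lambda>r. pderiv_at j (\<lambda>v'. \<Phi> r q v' w) v"]
    pderiv_at_pos_F[OF q]
  unfolding F_lin pderiv_at_linear by simp

lemma row_Inr: "leg (Inr a) k q = (\<Sum>r\<in>UNIV. (if r = Inr a then 1 else 0) * cmat r k q)"
  by (simp add: sum_UNIV_Plus leg_Inr cmat_simps if_distrib if_distribR cong: if_cong)

text \<open>
  With \<open>\<Phi>\<^sub>a = dF\<^sub>a/dt\<close>, both sides are \<open>\<partial>(dF\<^sub>a/dt)/\<partial>v\<^sup>j\<close>; the term \<open>\<partial>F\<^sub>j/\<partial>\<theta>\<^sup>a\<close> on the left is zero.
\<close>

lemma helmholtz_AB_Inr:
  assumes "q \<in> W"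
  shows "helmholtz_AB \<Phi> F (Inr a) j q v w"
  unfolding helmholtz_AB_iff[OF assms row_Inr] pderiv_at_vel_Phi[OF assms]
  by (simp add: sum_UNIV_Plus leg_Inr cmat_simps if_distrib if_distribR cong: if_cong)

text \<open>
  The first two sums of the side of \<open>(AA)\<close> form the position derivative of \<open>dF\<^sub>i/dt\<close>.
\<close>

lemma helmholtz_AA_side_eq:
  assumes q: "q \<in> W" and row: "\<And>k. leg i k q = (\<Sum>r\<in>UNIV. R r * cmat r k q)"
  shows "helmholtz_AA_side \<Phi> F i j q v w = pderiv_at j (\<lambda>q. dt_lin (leg i) q v w) q
    - (\<Sum>r\<in>UNIV. R r * pderiv_at j (\<lambda>q. \<Phi> r q v w) q)"
proof -
  have "pderiv_at j (\<lambda>q'. pderiv_at k (\<lambda>q''. F i q'' v) q') q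
      = pderiv_at j (\<lambda>q'. \<Sum>l\<in>UNIV. pderiv_at k (leg i l) q' * v $ l) q" for k
    by (rule pderiv_at_cong_open[OF open_W q pderiv_at_pos_F])
  moreover have "pderiv_at j (\<lambda>q'. pderiv_at k (\<lambda>v'. F i q' v') v) q = pderiv_at j (leg i k) q" for k
    unfolding F_lin pderiv_at_linear by simp
  moreover have "pderiv_at j (\<lambda>q. dt_lin (leg i) q v w) q
      = (\<Sum>k\<in>UNIV. pderiv_at j (\<lambda>q'. \<Sum>l\<in>UNIV. pderiv_at k (leg i l) q' * v $ l) q * v $ k)
        + (\<Sum>k\<in>UNIV. pderiv_at j (leg i k) q * w $ k)"
    unfolding dt_lin_def
    by (simp add: pderiv_at_add pderiv_at_sum pderiv_at_multc differentiable_sum_finite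
        twice_diff_onD[OF twice_diff_leg q] sum_distrib_right)
  ultimately show ?thesis
    unfolding helmholtz_AA_side_def
      C_inverse_contract[OF q row, where X = "\<lambda>r. pderiv_at j (\<lambda>q'. \<Phi> r q' v w) q"]
    by simp
qed

lemma dt_lin_leg_Inr:
  assumes "q \<in> W"
  shows "dt_lin (leg (Inr a)) q v w = \<Phi> (Inr a) q v w"
  by (simp add: Phi_eq[OF assms] leg_Inr[abs_def] cmat_simps[abs_def] dt_lin_def)

lemma helmholtz_AA_side_Inr:
  assumes "q \<in> W"
  shows "helmholtz_AA_side \<Phi> F (Inr a) j q v w = 0"
proof -
  have "pderiv_at j (\<lambda>q. dt_lin (leg (Inr a)) q v w) q = pderiv_at j (\<lambda>q. \<Phi> (Inr a) q v w) q"
    by (rule pderiv_at_cong_open[OF open_W assms dt_lin_leg_Inr])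
  then show ?thesis
    by (simp add: helmholtz_AA_side_eq[OF assms row_Inr] sum_UNIV_Plus if_distrib if_distribR
        cong: if_cong)
qed

lemma pderiv_at_shift:
  assumes "\<And>q x. f (q + x *\<^sub>R axis (Inr a) 1) = f q"
  shows "pderiv_at k f (q + x *\<^sub>R axis (Inr a) 1) = pderiv_at k f q"
proof -
  have "f (q + x *\<^sub>R axis (Inr a) 1 + y *\<^sub>R axis k 1) = f (q + y *\<^sub>R axis k 1)" for y
    using assms[of "q + y *\<^sub>R axis k 1" x] by (simp add: algebra_simps)
  then show ?thesis
    by (simp add: pderiv_at_def)
qed

lemma cmat_shift: "cmat i j (q + x *\<^sub>R axis (Inr a) 1) = cmat i j q"
  by (cases i; cases j) (simp_all add: cmat_def act_leg_def actuated_shift)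

text \<open>
  Invariance under translations of \<open>\<theta>\<close>: the actuated variables are cyclic.
\<close>

lemma Phi_shift:
  assumes "q \<in> W"
  shows "\<Phi> i (q + x *\<^sub>R axis (Inr a) 1) v w = \<Phi> i q v w"
proof -
  have "q + x *\<^sub>R axis (Inr a) 1 \<in> W"
    using assms by (simp add: W_iff)
  moreover have "lagrangian g V (q + x *\<^sub>R axis (Inr a) 1) v = lagrangian g V q v" for q x
    by (simp add: lagrangian_def)
  ultimately show ?thesis
    by (simp add: Phi_eq assms dt_lin_def dL_def pderiv_at_shift[OF cmat_shift] cmat_shift
        pderiv_at_shift[of "\<lambda>q. lagrangian g V q v"])
qed

lemma helmholtz_AA_side_Inr_right:
  assumes "q \<in> W"
  shows "helmholtz_AA_side \<Phi> F i (Inr b) q v w = 0"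
proof -
  have F: "controlled_F g \<tau> \<sigma> i (q + x *\<^sub>R axis (Inr b) 1) v = controlled_F g \<tau> \<sigma> i q v" for q x v
    by (simp add: controlled_F_def)
  have 1: "pderiv_at (Inr b) (\<lambda>q'. pderiv_at k (\<lambda>q''. F i q'' v) q') q = 0" for k
    unfolding pderiv_at_def[of "Inr b"] pderiv_at_shift[of "\<lambda>q''. F i q'' v", OF F] by simp
  have 2: "pderiv_at (Inr b) (\<lambda>q'. pderiv_at k (\<lambda>v'. F i q' v') v) q = 0" for k
    unfolding pderiv_at_def[of "Inr b"] F by simp
  have 3: "pderiv_at (Inr b) (\<lambda>q'. \<Phi> r q' v w) q = 0" for r
    unfolding pderiv_at_def[of "Inr b"] Phi_shift[OF assms] by simp
  show ?thesis
    unfolding helmholtz_AA_side_def 1 2 3 by simp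
qed


section \<open>One degree of underactuation\<close>

text \<open>
  With a single unactuated variable and constant \<open>g\<^sub>a\<^sub>b\<close> no \<open>\<Phi>\<^sub>r\<close> depends on the actuated velocities:
  the only candidate, \<open>\<partial>\<^sub>xg\<^sub>x\<^sub>b - \<partial>\<^sub>xg\<^sub>b\<^sub>x\<close>, cancels. So the right side of \<open>(AB)\<close> vanishes whatever \<open>C\<^sup>-\<^sup>1\<close>
  is, and the left side cancels in the same way.
\<close>

lemma helmholtz_AB_constant_metric:
  assumes q: "q \<in> W" and n1: "\<And>\<alpha> \<beta> :: 'n. \<alpha> = \<beta>"
    and const: "\<And>k a b. pderiv_at k (gq (Inr a) (Inr b)) q = 0"
  shows "helmholtz_AB \<Phi> F (Inl \<alpha>) (Inr b) q v w"
proof -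
  have act: "act_leg b (Inr c) = gq (Inr b) (Inr c)" for b c
    by (simp add: act_leg_def fun_eq_iff)
  have leg: "leg (Inl \<alpha>) (Inr b) = act_leg b (Inl \<alpha>)"
    by (simp add: leg_def fun_eq_iff)
  have U: "(UNIV :: 'n set) = {\<alpha>}"
    using n1 by auto
  have X: "pderiv_at (Inr b) (\<lambda>v. \<Phi> r q v w) v = 0" for r
  proof (cases r)
    case (Inl \<beta>)
    then show ?thesis
      by (simp add: n1[of \<beta> \<alpha>] pderiv_at_vel_Phi[OF q] sum_UNIV_Plus cmat_simps const U
        pderiv_gq_sym[OF q, of _ "Inr b" "Inl _"])
  next
    case (Inr a)
    then show ?thesis
      by (simp add: pderiv_at_vel_Phi[OF q] sum_UNIV_Plus cmat_simps act const)
  qed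
  show ?thesis
    unfolding helmholtz_AB_def X pderiv_at_pos_F[OF q]
    unfolding F_lin pderiv_at_linear
    by (simp add: sum_UNIV_Plus leg_Inr leg act const U)
qed


section \<open>Consequences of the matching conditions\<close>

text \<open>
  Vectors and matrices indexed by the actuated variables. The index placed first in \<open>dT\<close> and \<open>ddT\<close> is
  that of the last derivative taken. \<open>Gam \<alpha>\<close> is the logarithmic derivative \<open>G\<^sup>-\<^sup>1 \<partial>\<^sub>\<alpha>G\<close>, and
  \<open>T_dot \<alpha>\<close> is the time derivative of \<open>T \<alpha>\<close> along the motion.
\<close>

definition Gm :: "real^('n + 'm) \<Rightarrow> real^'m^'m" where "Gm q = (\<chi> a b. gq (Inr a) (Inr b) q)"
definition Sm :: "real^('n + 'm) \<Rightarrow> real^'m^'m" where "Sm q = (\<chi> a b. \<sigma>q a b q)"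
definition dG :: "'n \<Rightarrow> real^('n + 'm) \<Rightarrow> real^'m^'m" where
  "dG \<alpha> q = (\<chi> a b. pderiv_at (Inl \<alpha>) (gq (Inr a) (Inr b)) q)"
definition dS :: "'n \<Rightarrow> real^('n + 'm) \<Rightarrow> real^'m^'m" where
  "dS \<alpha> q = (\<chi> a b. pderiv_at (Inl \<alpha>) (\<sigma>q a b) q)"
definition Gam :: "'n \<Rightarrow> real^('n + 'm) \<Rightarrow> real^'m^'m" where
  "Gam \<alpha> q = matrix_inv (Gm q) ** dG \<alpha> q"
definition T :: "'n \<Rightarrow> real^('n + 'm) \<Rightarrow> real^'m" where "T \<alpha> q = (\<chi> a. \<tau>q a \<alpha> q)"
definition dT :: "'n \<Rightarrow> 'n \<Rightarrow> real^('n + 'm) \<Rightarrow> real^'m" where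
  "dT \<gamma> \<alpha> q = (\<chi> a. pderiv_at (Inl \<gamma>) (\<tau>q a \<alpha>) q)"
definition ddT :: "'n \<Rightarrow> 'n \<Rightarrow> 'n \<Rightarrow> real^('n + 'm) \<Rightarrow> real^'m" where
  "ddT \<beta> \<gamma> \<alpha> q = (\<chi> a. pderiv_at (Inl \<beta>) (pderiv_at (Inl \<gamma>) (\<tau>q a \<alpha>)) q)"
definition F_act :: "real^('n + 'm) \<Rightarrow> real^('n + 'm) \<Rightarrow> real^'m" where
  "F_act q v = (\<chi> a. \<Sum>k\<in>UNIV. act_leg a k q * v $ k)"
definition dF_act :: "'n \<Rightarrow> real^('n + 'm) \<Rightarrow> real^('n + 'm) \<Rightarrow> real^'m" where
  "dF_act \<alpha> q v = (\<chi> a. \<Sum>k\<in>UNIV. pderiv_at (Inl \<alpha>) (act_leg a k) q * v $ k)"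
definition T_dot :: "'n \<Rightarrow> real^('n + 'm) \<Rightarrow> real^('n + 'm) \<Rightarrow> real^'m" where
  "T_dot \<alpha> q v = (\<Sum>\<gamma>\<in>UNIV. v $ Inl \<gamma> *\<^sub>R dT \<gamma> \<alpha> q)"

lemma Gm_invertible:
  assumes "q \<in> W"
  shows "invertible (Gm q)"
  using pos_def_matrix_block_invertible[OF pos_def_g[of "xpart q"]] assms
  by (simp add: Gm_def gq_def W_iff)

lemma sym_matrices:
  assumes "q \<in> W"
  shows "transpose (Gm q) = Gm q" "transpose (Sm q) = Sm q"
    "transpose (dG \<alpha> q) = dG \<alpha> q" "transpose (dS \<alpha> q) = dS \<alpha> q"
proof -
  have "pderiv_at k (\<sigma>q a b) q = pderiv_at k (\<sigma>q b a) q" for k a b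
    by (rule pderiv_at_cong_open[OF open_W assms]) (rule \<sigma>q_sym)
  then show "transpose (dS \<alpha> q) = dS \<alpha> q"
    by (simp add: dS_def transpose_def vec_eq_iff)
qed (simp_all add: Gm_def Sm_def dG_def transpose_def vec_eq_iff gq_sym[OF assms, of "Inr _" "Inr _"]
    \<sigma>q_sym[OF assms] pderiv_gq_sym[OF assms, of _ "Inr _" "Inr _"])

lemma Gm_Gam:
  assumes "q \<in> W"
  shows "Gm q ** Gam \<alpha> q = dG \<alpha> q"
  by (simp add: Gam_def matrix_mul_assoc matrix_inv_cancel[OF Gm_invertible[OF assms]])

lemma act_block_eq: "act_block g (xpart q) = Gm q"
  by (simp add: act_block_def Gm_def gq_def)

lemma pderiv_at_x:
  "pderiv_at \<alpha> (\<lambda>y. g y $ i $ j) (xpart q) = pderiv_at (Inl \<alpha>) (gq i j) q"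
  "pderiv_at \<alpha> (\<lambda>y. \<tau> y $ a $ \<beta>) (xpart q) = pderiv_at (Inl \<alpha>) (\<tau>q a \<beta>) q"
  "pderiv_at \<alpha> (\<lambda>y. \<sigma> y $ a $ b) (xpart q) = pderiv_at (Inl \<alpha>) (\<sigma>q a b) q"
  unfolding gq_def[abs_def] \<tau>q_def[abs_def] \<sigma>q_def[abs_def] pderiv_at_def by simp_all

lemma M3_vec:
  assumes "cond_M3 U g \<tau>" and q: "q \<in> W"
  shows "dT \<beta> \<alpha> q - dT \<alpha> \<beta> q = Gam \<alpha> q *v T \<beta> q"
proof -
  have Gi: "matrix_inv (Gm q) $ d $ b = matrix_inv (Gm q) $ b $ d" for b d
    using matrix_inv_symmetric[OF Gm_invertible[OF q] sym_matrices(1)[OF q]]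
    by (simp add: transpose_def vec_eq_iff)
  have "(Gam \<alpha> q *v T \<beta> q) $ b = (\<Sum>d\<in>UNIV. \<Sum>a\<in>UNIV. matrix_inv (Gm q) $ d $ b
          * pderiv_at (Inl \<alpha>) (gq (Inr a) (Inr d)) q * \<tau>q a \<beta> q)" for b
    unfolding Gam_def matrix_vector_mul_assoc[symmetric]
    by (simp add: matrix_vector_mult_def dG_def T_def Gi[of _ b] sum_distrib_left mult.assoc
        pderiv_gq_sym[OF q, of _ "Inr _" "Inr _"])
  moreover have "pderiv_at (Inl \<beta>) (\<tau>q b \<alpha>) q - pderiv_at (Inl \<alpha>) (\<tau>q b \<beta>) q
      = (\<Sum>d\<in>UNIV. \<Sum>a\<in>UNIV. matrix_inv (Gm q) $ d $ b
          * pderiv_at (Inl \<alpha>) (gq (Inr a) (Inr d)) q * \<tau>q a \<beta> q)" for b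
    using assms(1)[unfolded cond_M3_def, rule_format, of "xpart q" \<beta> b \<alpha>] q
    by (simp add: W_iff pderiv_at_x act_block_eq \<tau>q_def)
  ultimately show ?thesis
    by (simp add: vec_eq_iff dT_def)
qed

lemma M3_lowered:
  assumes "cond_M3 U g \<tau>" and q: "q \<in> W"
  shows "Gm q *v (dT \<beta> \<alpha> q - dT \<alpha> \<beta> q) = dG \<alpha> q *v T \<beta> q"
  by (simp add: M3_vec[OF assms] matrix_vector_mul_assoc Gm_Gam[OF q])

lemma M1_lowered:
  assumes M1: "cond_M1 U g \<tau> \<sigma>" and inv: "\<forall>x\<in>U. invertible (\<sigma> x)" and q: "q \<in> W"
  shows "gq (Inl \<alpha>) (Inr c) q = - (\<Sum>b\<in>UNIV. \<sigma>q c b q * \<tau>q b \<alpha> q)"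
proof -
  let ?b = "\<chi> a. gq (Inl \<alpha>) (Inr a) q"
  have Si: "invertible (Sm q)"
    using inv q by (simp add: Sm_def \<sigma>q_def W_iff)
  have sym: "matrix_inv (Sm q) $ d $ b = matrix_inv (Sm q) $ b $ d" for b d
    using matrix_inv_symmetric[OF Si sym_matrices(2)[OF q]]
    by (simp add: transpose_def vec_eq_iff)
  have [simp]: "\<sigma> (xpart q) = Sm q"
    by (simp add: Sm_def \<sigma>q_def)
  have "T \<alpha> q = matrix_inv (Sm q) *v (- ?b)"
    using M1[unfolded cond_M1_def, rule_format, of "xpart q" _ \<alpha>] q
    by (simp add: W_iff vec_eq_iff T_def \<tau>q_def gq_def matrix_vector_mult_def sym sum_negf)
  then have "Sm q *v T \<alpha> q = - ?b"
    using matrix_inv_cancel(1)[OF Si] by (simp add: matrix_vector_mul_assoc)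
  then have "(Sm q *v T \<alpha> q) $ c = - gq (Inl \<alpha>) (Inr c) q"
    by simp
  then show ?thesis
    by (simp add: Sm_def T_def matrix_vector_mult_def)
qed

text \<open>
  M2 multiplied by \<open>S\<close> is \<open>dS + dG = 2 S \<Gamma>\<close>; subtracting this from \<open>2 dG = 2 G \<Gamma>\<close> shows that the
  combination \<open>H = G - S\<close> satisfies a linear equation of its own. Its left side is symmetric, which makes
  \<open>H \<Gamma>\<close> symmetric.
\<close>

lemma M2_vec:
  assumes M2: "cond_M2 U g \<sigma>" and inv: "\<forall>x\<in>U. invertible (\<sigma> x)" and q: "q \<in> W"
  shows "dG \<alpha> q - dS \<alpha> q = 2 *\<^sub>R ((Gm q - Sm q) ** Gam \<alpha> q)"
proof -
  have Si: "invertible (Sm q)"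
    using inv q by (simp add: Sm_def \<sigma>q_def W_iff)
  have [simp]: "\<sigma> (xpart q) = Sm q"
    by (simp add: Sm_def \<sigma>q_def)
  have hs: "pderiv_at (Inl \<alpha>) (gq (Inr a) (Inr d)) q = dG \<alpha> q $ d $ a"
    "pderiv_at (Inl \<alpha>) (\<sigma>q a d) q = dS \<alpha> q $ d $ a" for a d
    using sym_matrices(3,4)[OF q] by (simp_all add: dG_def dS_def transpose_def vec_eq_iff)
  have "matrix_inv (Sm q) ** (dS \<alpha> q + dG \<alpha> q) = 2 *\<^sub>R Gam \<alpha> q"
    using M2[unfolded cond_M2_def, rule_format, where x = "xpart q" and \<alpha> = \<alpha>] q
    by (simp add: W_iff vec_eq_iff pderiv_at_x act_block_eq hs Gam_def matrix_matrix_mult_def)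
  then have "Sm q ** (matrix_inv (Sm q) ** (dS \<alpha> q + dG \<alpha> q)) = Sm q ** (2 *\<^sub>R Gam \<alpha> q)"
    by simp
  then have "dS \<alpha> q + dG \<alpha> q = 2 *\<^sub>R (Sm q ** Gam \<alpha> q)"
    by (simp add: matrix_mul_assoc matrix_inv_cancel[OF Si] matrix_mult_scaleR_right)
  moreover have "(Gm q - Sm q) ** Gam \<alpha> q = dG \<alpha> q - Sm q ** Gam \<alpha> q"
    unfolding Gm_Gam[OF q, symmetric]
    by (simp add: vec_eq_iff matrix_matrix_mult_def sum_subtractf left_diff_distrib)
  ultimately show ?thesis
    by (simp add: scaleR_diff_right) (simp add: algebra_simps scaleR_2)
qed


section \<open>The conditions (AB) and (AA) under the matching conditions\<close>

definition T_vel :: "real^('n + 'm) \<Rightarrow> real^('n + 'm) \<Rightarrow> real^'m" where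
  "T_vel q v = (\<Sum>\<gamma>\<in>UNIV. v $ Inl \<gamma> *\<^sub>R T \<gamma> q)"

definition v_act :: "real^('n + 'm) \<Rightarrow> real^'m" where "v_act v = (\<chi> b. v $ Inr b)"

definition leg_col :: "'n \<Rightarrow> real^('n + 'm) \<Rightarrow> real^'m" where
  "leg_col \<beta> q = (\<chi> a. act_leg a (Inl \<beta>) q)"

lemma pderiv_act_leg_Inl:
  assumes "q \<in> W"
  shows "pderiv_at k (act_leg a (Inl \<gamma>)) q = pderiv_at k (gq (Inl \<gamma>) (Inr a)) q
    + (\<Sum>d\<in>UNIV. pderiv_at k (gq (Inr d) (Inr a)) q * \<tau>q d \<gamma> q
        + gq (Inr d) (Inr a) q * pderiv_at k (\<tau>q d \<gamma>) q)"
  by (simp add: act_leg_def[abs_def] pderiv_at_add pderiv_at_sum pderiv_at_mult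
      diff_gq[OF assms] diff_\<tau>q[OF assms] differentiable_sum_finite)

context
  assumes M3: "cond_M3 U g \<tau>"
begin

text \<open>
  Differentiating \<open>G (\<partial>\<^sub>\<beta>\<tau>\<^sub>\<alpha> - \<partial>\<^sub>\<alpha>\<tau>\<^sub>\<beta>) = (\<partial>\<^sub>\<alpha>G) \<tau>\<^sub>\<beta>\<close> leaves second derivatives of \<open>G\<close> (called \<open>X\<close> in the
  proof) that the conclusion does not contain. They are symmetric in the two derivatives, while \<open>Q\<close> is
  antisymmetric in its first two indices and has vanishing cyclic sum, being the derivative of the exterior
  derivative of \<open>\<tau>\<close>. Taking the differentiated equation for all permutations of the three indices
  then eliminates \<open>X\<close> by linear algebra.
\<close>

lemma M3_second_order:
  assumes q: "q \<in> W"
  shows "Gm q *v (ddT \<gamma> \<beta> \<alpha> q - ddT \<gamma> \<alpha> \<beta> q) = dG \<alpha> q *v dT \<gamma> \<beta> q - dG \<beta> q *v dT \<gamma> \<alpha> q"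
proof -
  have "(Gm q *v (ddT \<gamma> \<beta> \<alpha> q - ddT \<gamma> \<alpha> \<beta> q)) $ c
      = (dG \<alpha> q *v dT \<gamma> \<beta> q) $ c - (dG \<beta> q *v dT \<gamma> \<alpha> q) $ c" for c
  proof -
    define X where "X \<alpha> \<gamma> \<beta> = (\<Sum>a\<in>UNIV. pderiv_at (Inl \<gamma>) (pderiv_at (Inl \<alpha>) (gq (Inr c) (Inr a))) q * \<tau>q a \<beta> q)"
      for \<alpha> \<gamma> \<beta>
    define Y where "Y \<alpha> \<beta> \<gamma> = (dG \<alpha> q *v dT \<gamma> \<beta> q) $ c" for \<alpha> \<beta> \<gamma>
    define Q where "Q \<alpha> \<beta> \<gamma> = (Gm q *v (ddT \<gamma> \<beta> \<alpha> q - ddT \<gamma> \<alpha> \<beta> q)) $ c" for \<alpha> \<beta> \<gamma>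
    have X_sym: "X \<alpha> \<gamma> \<beta> = X \<gamma> \<alpha> \<beta>" for \<alpha> \<gamma> \<beta>
      by (simp add: X_def twice_diff_on_commute[OF open_W twice_diff_gq q, of "Inl \<alpha>"])
    have ddT_sym: "ddT \<alpha> \<gamma> \<beta> q = ddT \<gamma> \<alpha> \<beta> q" for \<alpha> \<gamma> \<beta>
      by (simp add: ddT_def twice_diff_on_commute[OF open_W twice_diff_\<tau>q q, of "Inl \<alpha>"])
    have Q_cyclic: "Q \<alpha> \<beta> \<gamma> + Q \<beta> \<gamma> \<alpha> + Q \<gamma> \<alpha> \<beta> = 0" for \<alpha> \<beta> \<gamma>
    proof -
      have "Q \<alpha> \<beta> \<gamma> + Q \<beta> \<gamma> \<alpha> + Q \<gamma> \<alpha> \<beta>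
          = (Gm q *v ((ddT \<gamma> \<beta> \<alpha> q - ddT \<gamma> \<alpha> \<beta> q) + (ddT \<alpha> \<gamma> \<beta> q - ddT \<alpha> \<beta> \<gamma> q)
              + (ddT \<beta> \<alpha> \<gamma> q - ddT \<beta> \<gamma> \<alpha> q))) $ c"
        unfolding Q_def by (simp add: matrix_vector_right_distrib)
      then show ?thesis
        by (simp add: ddT_sym[of \<gamma> \<beta> \<alpha>] ddT_sym[of \<alpha> \<gamma> \<beta>] ddT_sym[of \<beta> \<alpha> \<gamma>])
    qed
    have key: "Y \<gamma> \<alpha> \<beta> - Y \<gamma> \<beta> \<alpha> + Q \<alpha> \<beta> \<gamma> = X \<alpha> \<gamma> \<beta> + Y \<alpha> \<beta> \<gamma>" for \<alpha> \<beta> \<gamma>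
    proof -
      have "pderiv_at (Inl \<gamma>) (\<lambda>q. \<Sum>b\<in>UNIV. gq (Inr c) (Inr b) q
              * (pderiv_at (Inl \<beta>) (\<tau>q b \<alpha>) q - pderiv_at (Inl \<alpha>) (\<tau>q b \<beta>) q)) q
          = pderiv_at (Inl \<gamma>) (\<lambda>q. \<Sum>a\<in>UNIV. pderiv_at (Inl \<alpha>) (gq (Inr c) (Inr a)) q * \<tau>q a \<beta> q) q"
      proof (rule pderiv_at_cong_open[OF open_W q])
        fix q assume "q \<in> W"
        from arg_cong[OF M3_lowered[OF M3 this, of \<beta> \<alpha>], of "\<lambda>x. x $ c"]
        show "(\<Sum>b\<in>UNIV. gq (Inr c) (Inr b) q
              * (pderiv_at (Inl \<beta>) (\<tau>q b \<alpha>) q - pderiv_at (Inl \<alpha>) (\<tau>q b \<beta>) q))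
          = (\<Sum>a\<in>UNIV. pderiv_at (Inl \<alpha>) (gq (Inr c) (Inr a)) q * \<tau>q a \<beta> q)"
          by (simp add: matrix_vector_mult_def Gm_def dT_def dG_def T_def)
      qed
      then show ?thesis
        by (simp add: pderiv_at_sum pderiv_at_mult pderiv_at_diff twice_diff_onD[OF twice_diff_gq q] twice_diff_onD[OF twice_diff_\<tau>q q]
            sum.distrib X_def Y_def Q_def matrix_vector_mult_def Gm_def dT_def dG_def ddT_def
            right_diff_distrib sum_subtractf)
    qed
    have Q_anti: "Q \<alpha> \<beta> \<gamma> = - Q \<beta> \<alpha> \<gamma>" for \<alpha> \<beta> \<gamma>
      unfolding Q_def by (simp add: matrix_vector_mult_diff_distrib)
    have "Q \<alpha> \<beta> \<gamma> = Y \<alpha> \<beta> \<gamma> - Y \<beta> \<alpha> \<gamma>"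
      using key[of \<alpha> \<beta> \<gamma>] key[of \<beta> \<alpha> \<gamma>] key[of \<beta> \<gamma> \<alpha>] key[of \<gamma> \<beta> \<alpha>] key[of \<gamma> \<alpha> \<beta>] key[of \<alpha> \<gamma> \<beta>]
        Q_cyclic[of \<alpha> \<beta> \<gamma>] Q_anti[of \<alpha> \<beta> \<gamma>] Q_anti[of \<beta> \<gamma> \<alpha>] Q_anti[of \<gamma> \<alpha> \<beta>]
        X_sym[of \<alpha> \<gamma> \<beta>] X_sym[of \<alpha> \<beta> \<gamma>] X_sym[of \<beta> \<gamma> \<alpha>]
      by linarith
    then show ?thesis
      by (simp add: Q_def Y_def)
  qed
  then show ?thesis
    by (simp add: vec_eq_iff)
qed

end

context
  assumes inv_\<sigma>: "\<forall>x\<in>U. invertible (\<sigma> x)" and M1: "cond_M1 U g \<tau> \<sigma>"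
begin

text \<open>
  Beyond the stated combination of rows of \<open>C\<close>, the unactuated row of the Legendre matrix contains only
  \<open>(g\<^sub>\<alpha>\<^sub>a + \<sigma>\<^sub>a\<^sub>b\<tau>\<^sup>b\<^sub>\<alpha>) \<tau>\<^sup>a\<^sub>\<beta>\<close>, which M1 annihilates.
\<close>

lemma leg_Inl_eq:
  assumes q: "q \<in> W"
  shows "leg (Inl \<alpha>) k q = gq (Inl \<alpha>) k q + (\<Sum>a\<in>UNIV. \<tau>q a \<alpha> q * act_leg a k q)"
proof (cases k)
  case (Inl \<beta>)
  have "(\<Sum>a\<in>UNIV. gq (Inl \<alpha>) (Inr a) q * \<tau>q a \<beta> q)
      = - (\<Sum>a\<in>UNIV. \<Sum>b\<in>UNIV. \<sigma>q a b q * \<tau>q b \<alpha> q * \<tau>q a \<beta> q)"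
    by (simp add: M1_lowered[OF M1 inv_\<sigma> q] sum_distrib_right sum_negf)
  also have "(\<Sum>a\<in>UNIV. \<Sum>b\<in>UNIV. \<sigma>q a b q * \<tau>q b \<alpha> q * \<tau>q a \<beta> q)
      = (\<Sum>a\<in>UNIV. \<Sum>b\<in>UNIV. \<sigma>q a b q * \<tau>q a \<alpha> q * \<tau>q b \<beta> q)"
    by (subst sum.swap) (simp add: \<sigma>q_sym[OF q])
  moreover have "(\<Sum>a\<in>UNIV. \<tau>q a \<alpha> q * (\<Sum>d\<in>UNIV. gq (Inr d) (Inr a) q * \<tau>q d \<beta> q))
      = (\<Sum>a\<in>UNIV. \<Sum>b\<in>UNIV. gq (Inr a) (Inr b) q * \<tau>q a \<alpha> q * \<tau>q b \<beta> q)"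
    by (simp add: sum_distrib_left gq_sym[OF q, of "Inr _" "Inr _"] mult_ac)
  ultimately show ?thesis
    by (simp add: Inl leg_def act_leg_def distrib_left sum.distrib mult.commute)
next
  case (Inr b)
  then show ?thesis
    by (simp add: leg_def act_leg_def gq_sym[OF q, of "Inr b" "Inr _"] mult.commute)
qed

lemma row_Inl:
  assumes "q \<in> W"
  shows "leg (Inl \<alpha>) k q = (\<Sum>r\<in>UNIV. (case r of Inl \<beta> \<Rightarrow> if \<beta> = \<alpha> then 1 else 0 | Inr a \<Rightarrow> \<tau>q a \<alpha> q)
    * cmat r k q)"
  by (simp add: sum_UNIV_Plus leg_Inl_eq[OF assms] cmat_simps if_distrib if_distribR cong: if_cong)

lemma pderiv_leg_Inl:
  assumes q: "q \<in> W"
  shows "pderiv_at k (leg (Inl \<alpha>) l) q = pderiv_at k (gq (Inl \<alpha>) l) q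
    + (\<Sum>a\<in>UNIV. pderiv_at k (\<tau>q a \<alpha>) q * act_leg a l q + \<tau>q a \<alpha> q * pderiv_at k (act_leg a l) q)"
  by (simp add: pderiv_at_cong_open[OF open_W q leg_Inl_eq] pderiv_at_add pderiv_at_sum pderiv_at_mult
      diff_gq[OF q] diff_\<tau>q[OF q] diff_act_leg[OF q] differentiable_sum_finite)

text \<open>
  Once the row of the Legendre matrix is substituted, the terms in which \<open>\<tau>\<^sub>\<alpha>\<close> is not
  differentiated cancel against the right side of \<open>(AB)\<close>.
\<close>

lemma helmholtz_AB_Inl_iff:
  assumes q: "q \<in> W"
  shows "helmholtz_AB \<Phi> F (Inl \<alpha>) j q v w \<longleftrightarrow>
    (\<Sum>a\<in>UNIV. T_dot \<alpha> q v $ a * act_leg a j q) + (\<Sum>a\<in>UNIV. pderiv_at j (\<tau>q a \<alpha>) q * F_act q v $ a)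
    = (\<Sum>k\<in>UNIV. (pderiv_at (Inl \<alpha>) (leg j k) q - pderiv_at (Inl \<alpha>) (gq j k) q) * v $ k)"
proof -
  have T_dot: "T_dot \<alpha> q v $ a = (\<Sum>k\<in>UNIV. pderiv_at k (\<tau>q a \<alpha>) q * v $ k)" for a
    by (simp add: T_dot_def dT_def sum_UNIV_Plus mult.commute)
  have 1: "(\<Sum>k\<in>UNIV. pderiv_at k (leg (Inl \<alpha>) j) q * v $ k)
      = (\<Sum>k\<in>UNIV. pderiv_at k (gq (Inl \<alpha>) j) q * v $ k)
        + (\<Sum>a\<in>UNIV. T_dot \<alpha> q v $ a * act_leg a j q)
        + (\<Sum>a\<in>UNIV. \<tau>q a \<alpha> q * (\<Sum>k\<in>UNIV. pderiv_at k (act_leg a j) q * v $ k))"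
    unfolding T_dot pderiv_leg_Inl[OF q] distrib_right sum.distrib sum_distrib_left sum_distrib_right
    by (simp add: sum.swap[of _ "UNIV :: 'm set"] mult_ac)
  have 2: "(\<Sum>k\<in>UNIV. pderiv_at j (leg (Inl \<alpha>) k) q * v $ k)
      = (\<Sum>k\<in>UNIV. pderiv_at j (gq (Inl \<alpha>) k) q * v $ k)
        + (\<Sum>a\<in>UNIV. pderiv_at j (\<tau>q a \<alpha>) q * F_act q v $ a)
        + (\<Sum>a\<in>UNIV. \<tau>q a \<alpha> q * (\<Sum>k\<in>UNIV. pderiv_at j (act_leg a k) q * v $ k))"
    unfolding F_act_def pderiv_leg_Inl[OF q] distrib_right sum.distrib sum_distrib_left sum_distrib_right
    by (simp add: sum.swap[of _ "UNIV :: 'm set"] mult_ac sum_distrib_left)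
  show ?thesis
    unfolding helmholtz_AB_iff[OF q row_Inl[OF q]] 1 2 pderiv_at_vel_Phi[OF q]
    by (simp add: sum_UNIV_Plus[of "\<lambda>r. (case r of Inl \<beta> \<Rightarrow> _ \<beta> | Inr a \<Rightarrow> _ a) * _ r"]
        cmat_simps if_distrib if_distribR distrib_left sum.distrib left_diff_distrib sum_subtractf
        cong: if_cong) linarith
qed

context
  assumes M3: "cond_M3 U g \<tau>"
begin

text \<open>
  Every coefficient of \<open>v\<close> in the reduced condition is one component of M3 lowered by \<open>G\<close>.
\<close>

lemma helmholtz_AB_Inl_Inr:
  assumes q: "q \<in> W"
  shows "helmholtz_AB \<Phi> F (Inl \<alpha>) (Inr b) q v w"
proof -
  have "Gm q *v T_dot \<alpha> q v = (\<Sum>\<gamma>\<in>UNIV. v $ Inl \<gamma> *\<^sub>R (dG \<alpha> q *v T \<gamma> q + Gm q *v dT \<alpha> \<gamma> q))"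
    unfolding T_dot_def M3_lowered[OF M3 q, symmetric]
    by (simp add: matrix_vector_sum_scaleR matrix_vector_mult_diff_distrib)
  then have *: "(Gm q *v T_dot \<alpha> q v) $ b
      = (\<Sum>\<gamma>\<in>UNIV. v $ Inl \<gamma> * ((dG \<alpha> q *v T \<gamma> q) $ b + (Gm q *v dT \<alpha> \<gamma> q) $ b))"
    by simp
  have "(\<Sum>\<gamma>\<in>UNIV. (pderiv_at (Inl \<alpha>) (act_leg b (Inl \<gamma>)) q - pderiv_at (Inl \<alpha>) (gq (Inr b) (Inl \<gamma>)) q) * v $ Inl \<gamma>)
      = (\<Sum>\<gamma>\<in>UNIV. v $ Inl \<gamma> * ((dG \<alpha> q *v T \<gamma> q) $ b + (Gm q *v dT \<alpha> \<gamma> q) $ b))"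
    by (simp add: pderiv_act_leg_Inl[OF q] pderiv_gq_sym[OF q, of _ "Inr b"] gq_sym[OF q, of "Inr _" "Inr b"]
        sum.distrib matrix_vector_mult_def dG_def T_def Gm_def dT_def mult.commute)
  moreover have "act_leg b (Inr c) = gq (Inr b) (Inr c)" for b c
    by (simp add: act_leg_def fun_eq_iff)
  ultimately show ?thesis
    using * unfolding helmholtz_AB_Inl_iff[OF q]
    by (simp add: sum_UNIV_Plus leg_Inr matrix_vector_mult_def Gm_def
        gq_sym[OF q, of "Inr _" "Inr b"] mult.commute)
qed

end

context
  assumes M2: "cond_M2 U g \<sigma>" and M3: "cond_M3 U g \<tau>"
begin

text \<open>
  M1 lets \<open>g\<^sub>\<gamma>\<^sub>a\<close> be absorbed into \<open>\<sigma>\<close>, so that the metric's mixed block disappears from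
  everything that follows.
\<close>

lemma leg_col_eq:
  assumes q: "q \<in> W"
  shows "leg_col \<beta> q = (Gm q - Sm q) *v T \<beta> q"
  by (simp add: vec_eq_iff leg_col_def act_leg_def M1_lowered[OF M1 inv_\<sigma> q] matrix_vector_mult_def
      Gm_def Sm_def T_def gq_sym[OF q, of "Inr _" "Inr _"] left_diff_distrib sum_subtractf)

lemma F_act_eq:
  assumes q: "q \<in> W"
  shows "F_act q v = (Gm q - Sm q) *v T_vel q v + Gm q *v v_act v"
proof -
  have "F_act q v = (\<Sum>\<gamma>\<in>UNIV. v $ Inl \<gamma> *\<^sub>R leg_col \<gamma> q) + Gm q *v v_act v"
    by (simp add: vec_eq_iff F_act_def sum_UNIV_Plus leg_col_def matrix_vector_mult_def Gm_def v_act_def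
        act_leg_def mult.commute)
  then show ?thesis
    by (simp add: leg_col_eq[OF q] T_vel_def matrix_vector_sum_scaleR)
qed

lemma pderiv_leg_col:
  assumes q: "q \<in> W"
  shows "(\<chi> a. pderiv_at (Inl \<alpha>) (act_leg a (Inl \<gamma>)) q)
    = (dG \<alpha> q - dS \<alpha> q) *v T \<gamma> q + (Gm q - Sm q) *v dT \<alpha> \<gamma> q"
proof -
  have "pderiv_at (Inl \<alpha>) (act_leg a (Inl \<gamma>)) q
      = pderiv_at (Inl \<alpha>) (\<lambda>q. \<Sum>d\<in>UNIV. (gq (Inr a) (Inr d) q - \<sigma>q a d q) * \<tau>q d \<gamma> q) q" for a
  proof (rule pderiv_at_cong_open[OF open_W q])
    fix q :: "real^('n + 'm)" assume "q \<in> W"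
    from arg_cong[OF leg_col_eq[OF this, of \<gamma>], of "\<lambda>x. x $ a"]
    show "act_leg a (Inl \<gamma>) q = (\<Sum>d\<in>UNIV. (gq (Inr a) (Inr d) q - \<sigma>q a d q) * \<tau>q d \<gamma> q)"
      by (simp add: leg_col_def matrix_vector_mult_def Gm_def Sm_def T_def)
  qed
  then show ?thesis
    by (simp add: vec_eq_iff pderiv_at_sum pderiv_at_mult pderiv_at_diff diff_gq[OF q] diff_\<sigma>q[OF q]
        diff_\<tau>q[OF q] sum.distrib matrix_vector_mult_def dG_def dS_def Gm_def Sm_def T_def dT_def)
qed

text \<open>
  M2 produces \<open>2 H \<Gamma>\<^sub>\<alpha> \<tau>\<^sub>u\<close> from the derivative of \<open>H\<close>, and exchanging \<open>\<partial>\<^sub>\<alpha>\<tau>\<^sub>\<gamma>\<close> for \<open>\<partial>\<^sub>\<gamma>\<tau>\<^sub>\<alpha>\<close> by M3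
  costs one \<open>H \<Gamma>\<^sub>\<alpha> \<tau>\<^sub>u\<close>.
\<close>

lemma dF_act_eq:
  assumes q: "q \<in> W"
  shows "dF_act \<alpha> q v = ((Gm q - Sm q) ** Gam \<alpha> q) *v T_vel q v + (Gm q - Sm q) *v T_dot \<alpha> q v
    + dG \<alpha> q *v v_act v"
proof -
  let ?H = "Gm q - Sm q"
  have two: "(2 *\<^sub>R A) *v x = A *v x + A *v x" for A :: "real^'m^'m" and x
    unfolding scaleR_2 by (rule matrix_vector_mult_add_rdistrib)
  have "dF_act \<alpha> q v = (\<Sum>\<gamma>\<in>UNIV. v $ Inl \<gamma> *\<^sub>R (\<chi> a. pderiv_at (Inl \<alpha>) (act_leg a (Inl \<gamma>)) q))
      + dG \<alpha> q *v v_act v"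
    by (simp add: vec_eq_iff dF_act_def sum_UNIV_Plus matrix_vector_mult_def dG_def v_act_def
        act_leg_def[abs_def] mult.commute)
  also have "(\<lambda>\<gamma>. (\<chi> a. pderiv_at (Inl \<alpha>) (act_leg a (Inl \<gamma>)) q))
      = (\<lambda>\<gamma>. (?H ** Gam \<alpha> q) *v T \<gamma> q + ?H *v dT \<gamma> \<alpha> q)"
  proof
    fix \<gamma>
    have "dT \<alpha> \<gamma> q = dT \<gamma> \<alpha> q - Gam \<alpha> q *v T \<gamma> q"
      using M3_vec[OF M3 q, of \<gamma> \<alpha>] by (simp add: algebra_simps)
    then show "(\<chi> a. pderiv_at (Inl \<alpha>) (act_leg a (Inl \<gamma>)) q)
        = (?H ** Gam \<alpha> q) *v T \<gamma> q + ?H *v dT \<gamma> \<alpha> q"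
      unfolding pderiv_leg_col[OF q] M2_vec[OF M2 inv_\<sigma> q] two
      by (simp add: matrix_vector_mult_diff_distrib matrix_vector_mul_assoc)
  qed
  finally show ?thesis
    by (simp add: T_vel_def T_dot_def matrix_vector_sum_scaleR scaleR_add_right sum.distrib)
qed

text \<open>
  Because \<open>H \<Gamma>\<^sub>\<alpha>\<close> and \<open>G \<Gamma>\<^sub>\<alpha>\<close> are symmetric, as are \<open>H\<close> and \<open>G\<close>, the matrix \<open>\<Gamma>\<^sub>\<alpha>\<close> can be moved onto the
  test vector in both terms of \<open>f\<close> at once. Both remaining conditions are special cases.
\<close>

lemma inner_dF_act:
  assumes q: "q \<in> W"
  shows "x \<bullet> dF_act \<alpha> q v = (Gam \<alpha> q *v x) \<bullet> F_act q v + x \<bullet> ((Gm q - Sm q) *v T_dot \<alpha> q v)"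
proof -
  let ?H = "Gm q - Sm q"
  have "transpose (dG \<alpha> q - dS \<alpha> q) = dG \<alpha> q - dS \<alpha> q"
    using sym_matrices[OF q] by (simp add: vec_eq_iff transpose_def)
  then have HGam: "transpose (?H ** Gam \<alpha> q) = ?H ** Gam \<alpha> q"
    unfolding M2_vec[OF M2 inv_\<sigma> q] by (simp add: transpose_scalar vec_eq_iff transpose_def)
  have H: "transpose ?H = ?H"
    using sym_matrices[OF q] by (simp add: vec_eq_iff transpose_def)
  have "x \<bullet> ((?H ** Gam \<alpha> q) *v y) = (Gam \<alpha> q *v x) \<bullet> (?H *v y)" for y
    unfolding inner_symmetric_matrix[OF HGam, symmetric] inner_symmetric_matrix[OF H, symmetric]
    by (simp add: matrix_vector_mul_assoc)
  moreover have "x \<bullet> (dG \<alpha> q *v y) = (Gam \<alpha> q *v x) \<bullet> (Gm q *v y)" for y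
    unfolding inner_symmetric_matrix[OF sym_matrices(3)[OF q], symmetric]
      inner_symmetric_matrix[OF sym_matrices(1)[OF q], symmetric]
    by (simp add: matrix_vector_mul_assoc Gm_Gam[OF q])
  ultimately show ?thesis
    unfolding dF_act_eq[OF q] F_act_eq[OF q] by (simp add: inner_add_right)
qed

lemma helmholtz_AB_Inl_Inl:
  assumes q: "q \<in> W"
  shows "helmholtz_AB \<Phi> F (Inl \<alpha>) (Inl \<beta>) q v w"
proof -
  let ?H = "Gm q - Sm q"
  have H: "transpose ?H = ?H"
    using sym_matrices[OF q] by (simp add: vec_eq_iff transpose_def)
  have "T_dot \<alpha> q v \<bullet> leg_col \<beta> q + dT \<beta> \<alpha> q \<bullet> F_act q v = dT \<alpha> \<beta> q \<bullet> F_act q v + T \<beta> q \<bullet> dF_act \<alpha> q v"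
    unfolding inner_dF_act[OF q] leg_col_eq[OF q] M3_vec[OF M3 q, symmetric]
    using inner_symmetric_matrix[OF H, of "T_dot \<alpha> q v" "T \<beta> q"]
    by (simp add: inner_diff_right inner_commute)
  moreover have "(\<Sum>k\<in>UNIV. (pderiv_at (Inl \<alpha>) (leg (Inl \<beta>) k) q - pderiv_at (Inl \<alpha>) (gq (Inl \<beta>) k) q) * v $ k)
      = dT \<alpha> \<beta> q \<bullet> F_act q v + T \<beta> q \<bullet> dF_act \<alpha> q v"
    unfolding pderiv_leg_Inl[OF q] inner_vec_def dT_def F_act_def T_def dF_act_def
    by (simp add: distrib_left distrib_right sum.distrib sum_distrib_left sum_distrib_right
        sum.swap[of _ "UNIV :: 'm set"] mult_ac)
  ultimately show ?thesis
    unfolding helmholtz_AB_Inl_iff[OF q] by (simp add: inner_vec_def leg_col_def dT_def)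
qed

text \<open>
  The instances of \<open>inner_dF_act\<close> for the two time derivatives of \<open>\<tau>\<close> differ by
  \<open>(\<Gamma>\<^sub>\<beta> \<tau>'\<^sub>\<alpha> - \<Gamma>\<^sub>\<alpha> \<tau>'\<^sub>\<beta>) \<bullet> f\<close>, the terms with \<open>H\<close> being symmetric; contracting
  \<open>M3_second_order\<close> with the velocity shows that the second derivatives of \<open>\<tau>\<close> make up for this.
\<close>

lemma AA_velocity_terms_symmetric:
  assumes q: "q \<in> W"
  shows "(\<Sum>\<gamma>\<in>UNIV. v $ Inl \<gamma> *\<^sub>R ddT \<beta> \<gamma> \<alpha> q) \<bullet> F_act q v + T_dot \<alpha> q v \<bullet> dF_act \<beta> q v
    = (\<Sum>\<gamma>\<in>UNIV. v $ Inl \<gamma> *\<^sub>R ddT \<alpha> \<gamma> \<beta> q) \<bullet> F_act q v + T_dot \<beta> q v \<bullet> dF_act \<alpha> q v"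
proof -
  let ?H = "Gm q - Sm q"
  have H: "transpose ?H = ?H"
    using sym_matrices[OF q] by (simp add: vec_eq_iff transpose_def)
  have ddT_sym: "ddT \<alpha> \<gamma> \<beta> q = ddT \<gamma> \<alpha> \<beta> q" for \<alpha> \<gamma> \<beta>
    by (simp add: ddT_def twice_diff_on_commute[OF open_W twice_diff_\<tau>q q, of "Inl \<alpha>"])
  have D: "ddT \<gamma> \<beta> \<alpha> q - ddT \<gamma> \<alpha> \<beta> q = Gam \<alpha> q *v dT \<gamma> \<beta> q - Gam \<beta> q *v dT \<gamma> \<alpha> q" for \<gamma>
  proof -
    have "matrix_inv (Gm q) *v (Gm q *v (ddT \<gamma> \<beta> \<alpha> q - ddT \<gamma> \<alpha> \<beta> q))
        = matrix_inv (Gm q) *v (dG \<alpha> q *v dT \<gamma> \<beta> q - dG \<beta> q *v dT \<gamma> \<alpha> q)"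
      by (simp only: M3_second_order[OF M3 q])
    then show ?thesis
      by (simp add: Gam_def matrix_vector_mult_diff_distrib matrix_vector_mul_assoc
          matrix_inv_cancel[OF Gm_invertible[OF q]])
  qed
  have "(\<Sum>\<gamma>\<in>UNIV. v $ Inl \<gamma> *\<^sub>R ddT \<beta> \<gamma> \<alpha> q) - (\<Sum>\<gamma>\<in>UNIV. v $ Inl \<gamma> *\<^sub>R ddT \<alpha> \<gamma> \<beta> q)
      = (\<Sum>\<gamma>\<in>UNIV. v $ Inl \<gamma> *\<^sub>R (ddT \<gamma> \<beta> \<alpha> q - ddT \<gamma> \<alpha> \<beta> q))"
    by (simp add: ddT_sym[of \<beta>] ddT_sym[of \<alpha>] scaleR_diff_right sum_subtractf)
  also have "\<dots> = Gam \<alpha> q *v T_dot \<beta> q v - Gam \<beta> q *v T_dot \<alpha> q v"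
    unfolding D by (simp add: T_dot_def matrix_vector_sum_scaleR scaleR_diff_right sum_subtractf)
  finally have "(\<Sum>\<gamma>\<in>UNIV. v $ Inl \<gamma> *\<^sub>R ddT \<beta> \<gamma> \<alpha> q)
      = (\<Sum>\<gamma>\<in>UNIV. v $ Inl \<gamma> *\<^sub>R ddT \<alpha> \<gamma> \<beta> q) + Gam \<alpha> q *v T_dot \<beta> q v - Gam \<beta> q *v T_dot \<alpha> q v"
    by (simp add: algebra_simps)
  then show ?thesis
    unfolding inner_dF_act[OF q]
    using inner_symmetric_matrix[OF H, of "T_dot \<alpha> q v" "T_dot \<beta> q v"]
    by (simp add: inner_add_right inner_diff_right inner_commute)
qed

lemma dt_lin_leg_Inl:
  assumes q: "q \<in> W"
  shows "dt_lin (leg (Inl \<alpha>)) q v w = \<Phi> (Inl \<alpha>) q v w + dL (Inl \<alpha>) q v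
    + (\<Sum>a\<in>UNIV. (\<Sum>k\<in>UNIV. pderiv_at k (\<tau>q a \<alpha>) q * v $ k) * (\<Sum>j\<in>UNIV. act_leg a j q * v $ j)
        + \<tau>q a \<alpha> q * \<Phi> (Inr a) q v w)"
proof -
  have "dt_lin (leg (Inl \<alpha>)) q v w
      = dt_lin (\<lambda>j q. cmat (Inl \<alpha>) j q + (\<Sum>a\<in>UNIV. \<tau>q a \<alpha> q * act_leg a j q)) q v w"
    by (rule dt_lin_cong_open[OF open_W q]) (simp add: leg_Inl_eq cmat_simps)
  also have "\<dots> = dt_lin (cmat (Inl \<alpha>)) q v w + (\<Sum>a\<in>UNIV. dt_lin (\<lambda>j q. \<tau>q a \<alpha> q * act_leg a j q) q v w)"
    by (simp add: dt_lin_add dt_lin_sum diff_cmat[OF q] diff_\<tau>q[OF q] diff_act_leg[OF q]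
        differentiable_sum_finite)
  also have "(\<lambda>a. dt_lin (\<lambda>j q. \<tau>q a \<alpha> q * act_leg a j q) q v w) = (\<lambda>a.
      (\<Sum>k\<in>UNIV. pderiv_at k (\<tau>q a \<alpha>) q * v $ k) * (\<Sum>j\<in>UNIV. act_leg a j q * v $ j)
        + \<tau>q a \<alpha> q * \<Phi> (Inr a) q v w)"
  proof -
    have "leg (Inr a) = act_leg a" for a
      by (simp add: fun_eq_iff leg_Inr)
    then show ?thesis
      unfolding dt_lin_leg_Inr[OF q, symmetric]
      by (simp add: dt_lin_mult diff_\<tau>q[OF q] diff_act_leg[OF q])
  qed
  finally show ?thesis
    by (simp add: Phi_eq[OF q, of "Inl \<alpha>"])
qed

text \<open>
  The derivatives of the \<open>\<Phi>\<^sub>r\<close> in \<open>d/dt\<close> of \<open>F\<^sub>\<alpha>\<close> are exactly those subtracted by the last sum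
  of the side. The product rule also leaves \<open>(\<partial>\<^sub>\<beta>\<tau>\<^sup>a\<^sub>\<alpha>) \<Phi>\<^sub>a\<close>, which needs the equations of motion to
  disappear.
\<close>

lemma helmholtz_AA_side_Inl_Inl:
  assumes q: "q \<in> W" and zero: "\<And>i. \<Phi> i q v w = 0"
  shows "helmholtz_AA_side \<Phi> F (Inl \<alpha>) (Inl \<beta>) q v w
    = pderiv_at (Inl \<beta>) (\<lambda>q. dL (Inl \<alpha>) q v) q
      + ((\<Sum>\<gamma>\<in>UNIV. v $ Inl \<gamma> *\<^sub>R ddT \<beta> \<gamma> \<alpha> q) \<bullet> F_act q v + T_dot \<alpha> q v \<bullet> dF_act \<beta> q v)"
proof -
  let ?ud = "\<lambda>a q. \<Sum>k\<in>UNIV. pderiv_at k (\<tau>q a \<alpha>) q * v $ k"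
  let ?F = "\<lambda>a q. \<Sum>j\<in>UNIV. act_leg a j q * v $ j"
  have dud: "?ud a differentiable (at q)" for a
    by (intro differentiable_sum_finite differentiable_mult differentiable_const twice_diff_onD(2)[OF twice_diff_\<tau>q q])
  have dF: "?F a differentiable (at q)" for a
    by (intro differentiable_sum_finite differentiable_mult differentiable_const diff_act_leg[OF q])
  have ud: "?ud a q = T_dot \<alpha> q v $ a" for a
    by (simp add: T_dot_def dT_def sum_UNIV_Plus mult.commute)
  have F: "?F a q = F_act q v $ a" for a
    by (simp add: F_act_def)
  have pud: "pderiv_at (Inl \<beta>) (?ud a) q = (\<Sum>\<gamma>\<in>UNIV. v $ Inl \<gamma> *\<^sub>R ddT \<beta> \<gamma> \<alpha> q) $ a" for a
  proof -
    have "pderiv_at (Inr b) (\<tau>q a \<alpha>) = (\<lambda>q. 0)" for b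
      by (simp add: fun_eq_iff)
    then show ?thesis
      by (simp add: pderiv_at_sum pderiv_at_multc twice_diff_onD(2)[OF twice_diff_\<tau>q q] sum_UNIV_Plus ddT_def)
        (simp add: mult.commute)
  qed
  have pF: "pderiv_at (Inl \<beta>) (?F a) q = dF_act \<beta> q v $ a" for a
    by (simp add: pderiv_at_sum pderiv_at_multc diff_act_leg[OF q] dF_act_def)
  have summand: "pderiv_at (Inl \<beta>) (\<lambda>q. ?ud a q * ?F a q + \<tau>q a \<alpha> q * \<Phi> (Inr a) q v w) q
      = (\<Sum>\<gamma>\<in>UNIV. v $ Inl \<gamma> *\<^sub>R ddT \<beta> \<gamma> \<alpha> q) $ a * F_act q v $ a + T_dot \<alpha> q v $ a * dF_act \<beta> q v $ a
        + \<tau>q a \<alpha> q * pderiv_at (Inl \<beta>) (\<lambda>q. \<Phi> (Inr a) q v w) q" for a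
  proof -
    have "pderiv_at (Inl \<beta>) (\<lambda>q. ?ud a q * ?F a q + \<tau>q a \<alpha> q * \<Phi> (Inr a) q v w) q
      = (pderiv_at (Inl \<beta>) (?ud a) q * ?F a q + ?ud a q * pderiv_at (Inl \<beta>) (?F a) q)
        + (pderiv_at (Inl \<beta>) (\<tau>q a \<alpha>) q * \<Phi> (Inr a) q v w
            + \<tau>q a \<alpha> q * pderiv_at (Inl \<beta>) (\<lambda>q. \<Phi> (Inr a) q v w) q)"
      unfolding pderiv_at_mult[OF dud dF, symmetric]
        pderiv_at_mult[OF diff_\<tau>q[OF q] differentiable_Phi[OF q], symmetric]
      by (rule pderiv_at_add) (intro differentiable_mult dud dF diff_\<tau>q[OF q] differentiable_Phi[OF q])+
    then show ?thesis
      unfolding pud pF ud F zero by simp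
  qed
  have "pderiv_at (Inl \<beta>) (\<lambda>q. dt_lin (leg (Inl \<alpha>)) q v w) q
      = pderiv_at (Inl \<beta>) (\<lambda>q. \<Phi> (Inl \<alpha>) q v w + dL (Inl \<alpha>) q v
          + (\<Sum>a\<in>UNIV. ?ud a q * ?F a q + \<tau>q a \<alpha> q * \<Phi> (Inr a) q v w)) q"
    by (rule pderiv_at_cong_open[OF open_W q dt_lin_leg_Inl])
  also have "\<dots> = pderiv_at (Inl \<beta>) (\<lambda>q. \<Phi> (Inl \<alpha>) q v w) q
      + pderiv_at (Inl \<beta>) (\<lambda>q. dL (Inl \<alpha>) q v) q
      + (\<Sum>a\<in>UNIV. pderiv_at (Inl \<beta>) (\<lambda>q. ?ud a q * ?F a q + \<tau>q a \<alpha> q * \<Phi> (Inr a) q v w) q)"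
    by (subst pderiv_at_add, intro differentiable_add differentiable_Phi[OF q] differentiable_dL[OF q],
        intro differentiable_sum_finite differentiable_add differentiable_mult dud dF diff_\<tau>q[OF q]
          differentiable_Phi[OF q],
        subst pderiv_at_add[OF differentiable_Phi[OF q] differentiable_dL[OF q]], subst pderiv_at_sum,
        intro differentiable_add differentiable_mult dud dF diff_\<tau>q[OF q] differentiable_Phi[OF q],
        rule refl)
  finally show ?thesis
    unfolding helmholtz_AA_side_eq[OF q row_Inl[OF q]] summand
    by (simp add: sum_UNIV_Plus[of "\<lambda>r. (case r of Inl \<beta> \<Rightarrow> _ \<beta> | Inr a \<Rightarrow> _ a) * _ r"]
        if_distrib if_distribR sum.distrib inner_vec_def cong: if_cong)
qed

lemma helmholtz_AA_Inl_Inl: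
  assumes q: "q \<in> W" and zero: "\<And>i. \<Phi> i q v w = 0"
  shows "helmholtz_AA \<Phi> F (Inl \<alpha>) (Inl \<beta>) q v w"
  unfolding helmholtz_AA_def helmholtz_AA_side_Inl_Inl[OF assms]
  using AA_velocity_terms_symmetric[OF q, of v \<beta> \<alpha>] dL_commute[OF q, of "Inl \<beta>" "Inl \<alpha>" v] by simp

end
end
end


section \<open>The theorem\<close>

theorem mainTheorem3:
  fixes U :: "(real^'n::finite) set"
    and g :: "real^'n \<Rightarrow> real^('n + 'm::finite)^('n + 'm)"
    and V :: "real^'n \<Rightarrow> real"
    and \<tau> :: "real^'n \<Rightarrow> real^'n^'m"
    and \<sigma> :: "real^'n \<Rightarrow> real^'m^'m"
    and \<Phi> :: "'n + 'm \<Rightarrow> real^('n + 'm) \<Rightarrow> real^('n + 'm) \<Rightarrow> real^('n + 'm) \<Rightarrow> real"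
    and F :: "'n + 'm \<Rightarrow> real^('n + 'm) \<Rightarrow> real^('n + 'm) \<Rightarrow> real"
  assumes "open U"
    and "\<And>i j. smooth_on U (\<lambda>x. g x $ i $ j)"
    and "smooth_on U V"
    and "\<And>a \<alpha>. smooth_on U (\<lambda>x. \<tau> x $ a $ \<alpha>)"
    and "\<And>a b. smooth_on U (\<lambda>x. \<sigma> x $ a $ b)"
    and "\<And>x. x \<in> U \<Longrightarrow> pos_def_matrix (g x)"
    and "\<And>x. x \<in> U \<Longrightarrow> transpose (\<sigma> x) = \<sigma> x"
    and "\<Phi> = controlled_EL g V \<tau>"
    and "F = controlled_F g \<tau> \<sigma>"
    and "identically_on U (\<lambda>q v w. invertible (acc_matrix \<Phi> q v w))"
  shows
    "(\<forall>i j. identically_on U (\<lambda>q v w. helmholtz_B F i j q v))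
     \<and>
     (\<forall>a b. identically_on U (helmholtz_AB \<Phi> F (Inr a) (Inr b))) \<and>
     (\<forall>a \<beta>. identically_on U (helmholtz_AB \<Phi> F (Inr a) (Inl \<beta>))) \<and>
     ((\<forall>x\<in>U. invertible (\<sigma> x)) \<and> cond_M1 U g \<tau> \<sigma> \<and> cond_M3 U g \<tau> \<longrightarrow>
       (\<forall>\<alpha> b. identically_on U (helmholtz_AB \<Phi> F (Inl \<alpha>) (Inr b)))) \<and>
     ((\<forall>x\<in>U. \<forall>y\<in>U. act_block g x = act_block g y) \<and> CARD('n) = 1 \<longrightarrow>
       (\<forall>\<alpha> b. identically_on U (helmholtz_AB \<Phi> F (Inl \<alpha>) (Inr b)))) \<and>
     ((\<forall>x\<in>U. invertible (\<sigma> x)) \<and> cond_M1 U g \<tau> \<sigma> \<and> cond_M2 U g \<sigma> \<and> cond_M3 U g \<tau> \<longrightarrow>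
       (\<forall>\<alpha> \<beta>. identically_on U (helmholtz_AB \<Phi> F (Inl \<alpha>) (Inl \<beta>))))
     \<and>
     (\<forall>a b. identically_on U (helmholtz_AA \<Phi> F (Inr a) (Inr b))) \<and>
     (\<forall>\<alpha> b. identically_on U (helmholtz_AA \<Phi> F (Inl \<alpha>) (Inr b))) \<and>
     ((\<forall>x\<in>U. invertible (\<sigma> x)) \<and> cond_M1 U g \<tau> \<sigma> \<and> cond_M2 U g \<sigma> \<and> cond_M3 U g \<tau> \<longrightarrow>
       (\<forall>\<alpha> \<beta>. identically_on U (\<lambda>q v w. (\<forall>i. \<Phi> i q v w = 0) \<longrightarrow>
          helmholtz_AA \<Phi> F (Inl \<alpha>) (Inl \<beta>) q v w))) \<and>
     (CARD('n) = 1 \<longrightarrow>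
       (\<forall>\<alpha> \<beta>. identically_on U (helmholtz_AA \<Phi> F (Inl \<alpha>) (Inl \<beta>))))"
proof -
  interpret controlled_system U g V \<tau> \<sigma>
    by unfold_locales
      (use assms in \<open>simp_all add: smooth_on_imp_twice_diff_on identically_on_def\<close>)
  have eqs: "\<Phi> = controlled_EL g V \<tau>" "F = controlled_F g \<tau> \<sigma>"
    by (fact assms)+
  have on_W: "identically_on U P" if "\<And>q v w. q \<in> W \<Longrightarrow> P q v w" for P
    using that by (simp add: identically_on_def W_iff)
  have n1: "\<alpha> = \<beta>" if "CARD('n) = 1" for \<alpha> \<beta> :: 'n
    using that by (metis UNIV_I card_1_singletonE singletonD)
  have const: "pderiv_at k (gq (Inr a) (Inr b)) q = 0"
    if "\<forall>x\<in>U. \<forall>y\<in>U. act_block g x = act_block g y" "q \<in> W" for k a b q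
  proof -
    have "pderiv_at k (gq (Inr a) (Inr b)) q = pderiv_at k (\<lambda>_. gq (Inr a) (Inr b) q) q"
    proof (rule pderiv_at_cong_open[OF open_W that(2)])
      fix p assume "p \<in> W"
      then have "act_block g (xpart p) $ a $ b = act_block g (xpart q) $ a $ b"
        using that by (metis W_iff)
      then show "gq (Inr a) (Inr b) p = gq (Inr a) (Inr b) q"
        by (simp add: act_block_def gq_def)
    qed
    then show ?thesis
      by simp
  qed
  have AB_constant: "helmholtz_AB \<Phi> F (Inl \<alpha>) (Inr b) q v w"
    if "\<forall>x\<in>U. \<forall>y\<in>U. act_block g x = act_block g y" "CARD('n) = 1" "q \<in> W" for \<alpha> b q v w
    unfolding eqs
    by (rule helmholtz_AB_constant_metric[OF that(3) n1[OF that(2)] const[OF that(1,3)]])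
  have AA_one: "helmholtz_AA \<Phi> F (Inl \<alpha>) (Inl \<beta>) q v w" if "CARD('n) = 1" for \<alpha> \<beta> q v w
    unfolding n1[OF that, of \<alpha> \<beta>] helmholtz_AA_def by (rule refl)
  have AA_Inr: "helmholtz_AA \<Phi> F i (Inr b) q v w" if "q \<in> W" for i b q v w
    unfolding eqs helmholtz_AA_def
    by (simp add: helmholtz_AA_side_Inr[OF that] helmholtz_AA_side_Inr_right[OF that])
  show ?thesis
    by (intro conjI allI impI on_W; (elim conjE)?;
        (rule AB_constant AA_one AA_Inr; assumption)?;
        (unfold eqs,
          (rule helmholtz_B_holds helmholtz_AB_Inr helmholtz_AB_Inl_Inr helmholtz_AB_Inl_Inl
            helmholtz_AA_Inl_Inl; blast))?)
qed

end
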